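(* Let $\Gamma$ be the cross-section of an immersed compact $SO(2)$-rotationally symmetric self-shrinking hypersurface $\Sigma\subset\mathbb{R}^{n+1}$ that does not intersect the axis of rotation $r=0$. Let $u\colon\Gamma\to\mathbb{R}$ be defined by $$u=\sigma^{-1}=\frac Cre^{|x|^2/4},\qquad C=\frac{(4\pi)^{n/2}}{2\pi}.$$ Then $$L_1u=\left(\frac n2-R_\Gamma\right)u,$$ where $R_\Gamma$ is the scalar curvature of $\Gamma$.
   Context: Write $\mathbb{R}^{n+1}=\mathbb{R}^2\times\mathbb{R}^{n-1}$ with coordinates $x=(r,\theta,z)$, where $(r,\theta)$ are polar coordinates on $\mathbb{R}^2$ and $z\in\mathbb{R}^{n-1}$; $e_r$ is the unit radial vector and $|x|^2=r^2+|z|^2$. A hypersurface is $SO(2)$-rotationally symmetric if it is invariant under $SO(2)$ acting on the first two coordinates. Its cross-section $\Gamma$ is its $\theta=0$ slice, an (immersed) $(n-1)$-dimensional hypersurface in the half-space $\{(r,z):r\ge0,\ z\in\mathbb{R}^{n-1}\}$. For an immersed oriented hypersurface with unit normal $\mathbf{n}$, write $v^\perp=\langle v,\mathbf{n}\rangle$, $A(v,w)=(\nabla_vw)^\perp$, $H=-\operatorname{tr}A$. $\Sigma$ is a self-shrinker if $\sqrt{-t}\,\Sigma$, $t<0$, evolves by mean curvature flow $\dot x=-H_\Sigma\mathbf{n}$; equivalently $H_\Sigma=\frac12x^\perp$, or in terms of $\Gamma$, $H_\Gamma=\frac12x^\perp-\frac1re_r^\perp$. Let $\sigma=\frac{2\pi}{(4\pi)^{n/2}}re^{-|x|^2/4}$.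 With respect to the Euclidean metric, let $\mathcal{L}_\Gamma u=\sigma^{-1}\operatorname{div}_\Gamma(\sigma\operatorname{grad}_\Gamma u)$ and, for a nonnegative integer $k$, let the $k$th Fourier component of the stability operator be $$L_k=\mathcal{L}_\Gamma+|A_\Gamma|^2+\frac1{r^2}|e_r^\perp|^2+\frac12-\frac{k^2}{r^2},$$ acting on functions on $\Gamma$, where $A_\Gamma$ is the second fundamental form of $\Gamma$ in the Euclidean half-space. The scalar curvature of $\Gamma$ is that of the induced Euclidean metric (and is $0$ when $\Gamma$ is one-dimensional). *)

theory Defs
  imports "HOL-Analysis.Analysis"
begin

section \<open>Smooth maps between Euclidean spaces\<close>

definition partial :: "'n::finite \<Rightarrow> (real^'n \<Rightarrow> 'b::real_normed_vector) \<Rightarrow> real^'n \<Rightarrow> 'b" where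
  "partial i f x = frechet_derivative f (at x) (axis i 1)"

primrec Ck_on :: "nat \<Rightarrow> (real^'n::finite \<Rightarrow> 'b::real_normed_vector) \<Rightarrow> (real^'n) set \<Rightarrow> bool" where
  "Ck_on 0 f U \<longleftrightarrow> continuous_on U f"
| "Ck_on (Suc k) f U \<longleftrightarrow> (\<forall>x\<in>U. f differentiable (at x)) \<and> (\<forall>i. Ck_on k (partial i f) U)"

text \<open>Only meant for open \<open>U\<close>, because the derivatives are taken at interior points.\<close>

definition smooth_on :: "(real^'n::finite \<Rightarrow> 'b::real_normed_vector) \<Rightarrow> (real^'n) set \<Rightarrow> bool" where
  "smooth_on f U \<longleftrightarrow> (\<forall>k. Ck_on k f U)"

section \<open>Immersed oriented hypersurfaces\<close>

text \<open>An immersed hypersurface is an abstract manifold, given by a topology and an atlas, together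
  with an immersion \<open>position\<close> into the ambient space and a unit normal field along it.
  Elements \<open>(U, \<phi>)\<close> of the atlas are local parametrizations \<open>\<phi> : U \<rightarrow> M\<close>, i.e. inverse charts.\<close>

record ('p, 'n, 'b) hypersurface =
  manifold :: "'p topology"
  atlas :: "((real^'n) set \<times> (real^'n \<Rightarrow> 'p)) set"
  position :: "'p \<Rightarrow> 'b"
  unit_normal :: "'p \<Rightarrow> 'b"

definition local_parametrization ::
  "'p topology \<Rightarrow> (real^'n::finite) set \<Rightarrow> (real^'n \<Rightarrow> 'p) \<Rightarrow> bool" where
  "local_parametrization M U \<phi> \<longleftrightarrow> open U \<and> openin M (\<phi> ` U) \<and>
     homeomorphic_map (top_of_set U) (subtopology M (\<phi> ` U)) \<phi>"

definition smooth_atlas ::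
  "'p topology \<Rightarrow> ((real^'n::finite) set \<times> (real^'n \<Rightarrow> 'p)) set \<Rightarrow> bool" where
  "smooth_atlas M \<A> \<longleftrightarrow>
     (\<forall>(U, \<phi>)\<in>\<A>. local_parametrization M U \<phi>) \<and>
     (\<Union>(U, \<phi>)\<in>\<A>. \<phi> ` U) = topspace M \<and>
     (\<forall>(U, \<phi>)\<in>\<A>. \<forall>(V, \<psi>)\<in>\<A>. smooth_on (inv_into V \<psi> \<circ> \<phi>) {x \<in> U. \<phi> x \<in> \<psi> ` V})"

definition smooth_immersion_on ::
  "(real^'n::finite \<Rightarrow> 'b::real_normed_vector) \<Rightarrow> (real^'n) set \<Rightarrow> bool" where
  "smooth_immersion_on X U \<longleftrightarrow> smooth_on X U \<and> (\<forall>x\<in>U. inj (frechet_derivative X (at x)))"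

text \<open>Second countability is not required separately: it is automatic for compact manifolds and
  for their slices, which are the only hypersurfaces considered here.\<close>

definition immersed_hypersurface ::
  "('p, 'n::finite, 'b::euclidean_space) hypersurface \<Rightarrow> bool" where
  "immersed_hypersurface S \<longleftrightarrow>
     DIM('b) = CARD('n) + 1 \<and>
     Hausdorff_space (manifold S) \<and>
     smooth_atlas (manifold S) (atlas S) \<and>
     (\<forall>(U, \<phi>)\<in>atlas S. smooth_immersion_on (position S \<circ> \<phi>) U) \<and>
     continuous_map (manifold S) euclidean (unit_normal S) \<and>
     (\<forall>p\<in>topspace (manifold S). norm (unit_normal S p) = 1) \<and>
     (\<forall>(U, \<phi>)\<in>atlas S. \<forall>x\<in>U. \<forall>i. partial i (position S \<circ> \<phi>) x \<bullet> unit_normal S (\<phi> x) = 0)"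

section \<open>Geometry in a local parametrization\<close>

text \<open>Below, \<open>X\<close> is an immersion of an open subset of \<open>real^'n\<close>, \<open>N\<close> a unit normal field along it,
  and functions on the hypersurface are given by their coordinate expressions.\<close>

definition metric :: "(real^'n::finite \<Rightarrow> 'b::euclidean_space) \<Rightarrow> real^'n \<Rightarrow> real^'n^'n" where
  "metric X x = (\<chi> i j. partial i X x \<bullet> partial j X x)"

definition inv_metric :: "(real^'n::finite \<Rightarrow> 'b::euclidean_space) \<Rightarrow> real^'n \<Rightarrow> real^'n^'n" where
  "inv_metric X x = matrix_inv (metric X x)"

definition christoffel ::
  "(real^'n::finite \<Rightarrow> 'b::euclidean_space) \<Rightarrow> 'n \<Rightarrow> 'n \<Rightarrow> 'n \<Rightarrow> real^'n \<Rightarrow> real" where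
  "christoffel X k i j x = (1/2) * (\<Sum>l\<in>UNIV. inv_metric X x $ k $ l *
     (partial i (\<lambda>y. metric X y $ j $ l) x + partial j (\<lambda>y. metric X y $ i $ l) x
      - partial l (\<lambda>y. metric X y $ i $ j) x))"

text \<open>The \<open>l\<close>-component of \<open>R(\<partial>\<^sub>i, \<partial>\<^sub>j)\<partial>\<^sub>k\<close>; with this sign, round spheres have positive scalar curvature.\<close>

definition riemann ::
  "(real^'n::finite \<Rightarrow> 'b::euclidean_space) \<Rightarrow> 'n \<Rightarrow> 'n \<Rightarrow> 'n \<Rightarrow> 'n \<Rightarrow> real^'n \<Rightarrow> real" where
  "riemann X l i j k x =
     partial i (christoffel X l j k) x - partial j (christoffel X l i k) x
     + (\<Sum>p\<in>UNIV. christoffel X l i p x * christoffel X p j k x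
                  - christoffel X l j p x * christoffel X p i k x)"

definition ricci ::
  "(real^'n::finite \<Rightarrow> 'b::euclidean_space) \<Rightarrow> 'n \<Rightarrow> 'n \<Rightarrow> real^'n \<Rightarrow> real" where
  "ricci X j k x = (\<Sum>i\<in>UNIV. riemann X i i j k x)"

definition scalar_curvature ::
  "(real^'n::finite \<Rightarrow> 'b::euclidean_space) \<Rightarrow> real^'n \<Rightarrow> real" where
  "scalar_curvature X x = (\<Sum>j\<in>UNIV. \<Sum>k\<in>UNIV. inv_metric X x $ j $ k * ricci X j k x)"

definition surf_grad ::
  "(real^'n::finite \<Rightarrow> 'b::euclidean_space) \<Rightarrow> (real^'n \<Rightarrow> real) \<Rightarrow> real^'n \<Rightarrow> real^'n" where
  "surf_grad X f x = (\<chi> i. \<Sum>j\<in>UNIV. inv_metric X x $ i $ j * partial j f x)"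

definition surf_div ::
  "(real^'n::finite \<Rightarrow> 'b::euclidean_space) \<Rightarrow> (real^'n \<Rightarrow> real^'n) \<Rightarrow> real^'n \<Rightarrow> real" where
  "surf_div X W x = (\<Sum>i\<in>UNIV. partial i (\<lambda>y. W y $ i) x
     + (\<Sum>j\<in>UNIV. christoffel X i i j x * W x $ j))"

text \<open>\<open>A(v, w) = (\<nabla>\<^sub>v w)\<^sup>\<bottom>\<close> evaluated on coordinate fields.\<close>

definition second_ff ::
  "(real^'n::finite \<Rightarrow> 'b::euclidean_space) \<Rightarrow> (real^'n \<Rightarrow> 'b) \<Rightarrow> 'n \<Rightarrow> 'n \<Rightarrow> real^'n \<Rightarrow> real" where
  "second_ff X N i j x = partial i (partial j X) x \<bullet> N x"

definition mean_curvature ::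
  "(real^'n::finite \<Rightarrow> 'b::euclidean_space) \<Rightarrow> (real^'n \<Rightarrow> 'b) \<Rightarrow> real^'n \<Rightarrow> real" where
  "mean_curvature X N x = - (\<Sum>i\<in>UNIV. \<Sum>j\<in>UNIV. inv_metric X x $ i $ j * second_ff X N i j x)"

definition second_ff_norm_sq ::
  "(real^'n::finite \<Rightarrow> 'b::euclidean_space) \<Rightarrow> (real^'n \<Rightarrow> 'b) \<Rightarrow> real^'n \<Rightarrow> real" where
  "second_ff_norm_sq X N x = (\<Sum>i\<in>UNIV. \<Sum>j\<in>UNIV. \<Sum>k\<in>UNIV. \<Sum>l\<in>UNIV.
     inv_metric X x $ i $ k * inv_metric X x $ j $ l * second_ff X N i j x * second_ff X N k l x)"

section \<open>Self-shrinkers\<close>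

text \<open>The flow \<open>x' = - H n\<close> of hypersurfaces is understood up to tangential reparametrization, so only
  the normal component of the velocity is prescribed (as needed for \<open>sqrt (-t) \<Sigma>\<close>, whose velocity
  is radial).\<close>

definition mean_curvature_flow ::
  "real set \<Rightarrow> (real \<Rightarrow> ('p, 'n::finite, 'b::euclidean_space) hypersurface) \<Rightarrow> bool" where
  "mean_curvature_flow I S \<longleftrightarrow>
     (\<forall>t\<in>I. \<forall>(U, \<phi>)\<in>atlas (S t). \<forall>x\<in>U.
        \<exists>v. ((\<lambda>s. position (S s) (\<phi> x)) has_vector_derivative v) (at t) \<and>
            v \<bullet> unit_normal (S t) (\<phi> x) =
              - mean_curvature (position (S t) \<circ> \<phi>) (unit_normal (S t) \<circ> \<phi>) x)"

definition rescale ::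
  "real \<Rightarrow> ('p, 'n::finite, 'b::euclidean_space) hypersurface \<Rightarrow> ('p, 'n, 'b) hypersurface" where
  "rescale c S = S\<lparr>position := (\<lambda>p. c *\<^sub>R position S p)\<rparr>"

definition self_shrinker :: "('p, 'n::finite, 'b::euclidean_space) hypersurface \<Rightarrow> bool" where
  "self_shrinker S \<longleftrightarrow> mean_curvature_flow {..<0} (\<lambda>t. rescale (sqrt (- t)) S)"

lemma partial_scaleR:
  assumes "X differentiable (at x)"
  shows "partial i (\<lambda>y. c *\<^sub>R X y) x = c *\<^sub>R partial i X x"
proof -
  have "((\<lambda>y. c *\<^sub>R X y) has_derivative (\<lambda>h. c *\<^sub>R frechet_derivative X (at x) h)) (at x)"
    using assms by (intro has_derivative_scaleR_right) (simp add: frechet_derivative_works)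
  then show ?thesis by (simp add: partial_def frechet_derivative_at[symmetric])
qed

lemma partial_cong_open:
  assumes "open U" "x \<in> U" "\<And>y. y \<in> U \<Longrightarrow> f y = g y"
  shows "partial i f x = partial i g x"
proof -
  have "(f has_derivative D) (at x) \<longleftrightarrow> (g has_derivative D) (at x)" for D
    using assms by (metis has_derivative_transform_within_open)
  then show ?thesis by (simp add: partial_def frechet_derivative_def)
qed

lemma matrix_inv_scaleR:
  fixes M :: "real^'n^'n"
  assumes "invertible M" "c \<noteq> 0"
  shows "matrix_inv (c *\<^sub>R M) = inverse c *\<^sub>R matrix_inv M"
proof -
  have 1: "M ** matrix_inv M = mat 1 \<and> matrix_inv M ** M = mat 1"
    using assms(1) unfolding invertible_def matrix_inv_def by (rule someI_ex)
  have sc: "(a *\<^sub>R A) ** (b *\<^sub>R B) = (a * b) *\<^sub>R (A ** B)" for a b :: real and A B :: "real^'n^'n"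
    by (simp add: matrix_matrix_mult_def vec_eq_iff sum_distrib_left mult_ac)
  let ?B = "inverse c *\<^sub>R matrix_inv M"
  have B: "(c *\<^sub>R M) ** ?B = mat 1 \<and> ?B ** (c *\<^sub>R M) = mat 1"
    using 1 assms(2) by (simp add: sc)
  then have "(c *\<^sub>R M) ** matrix_inv (c *\<^sub>R M) = mat 1 \<and> matrix_inv (c *\<^sub>R M) ** (c *\<^sub>R M) = mat 1"
    unfolding matrix_inv_def by (rule someI)
  then show ?thesis
    using B by (metis matrix_mul_assoc matrix_mul_lid matrix_mul_rid)
qed

lemma metric_invertible:
  fixes X :: "real^'n::finite \<Rightarrow> 'b::euclidean_space"
  assumes "X differentiable (at x)" "inj (frechet_derivative X (at x))"
  shows "invertible (metric X x)"
proof -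
  let ?D = "frechet_derivative X (at x)"
  have lin: "linear ?D" using assms(1) by (rule linear_frechet_derivative)
  have D: "?D v = (\<Sum>i\<in>UNIV. v $ i *\<^sub>R partial i X x)" for v
  proof -
    have "?D v = ?D (\<Sum>i\<in>UNIV. v $ i *\<^sub>R axis i 1)"
      using basis_expansion[of v] by (simp add: scalar_mult_eq_scaleR)
    also have "\<dots> = (\<Sum>i\<in>UNIV. v $ i *\<^sub>R partial i X x)"
      by (simp add: linear_sum[OF lin] linear_cmul[OF lin] partial_def o_def)
    finally show ?thesis .
  qed
  have "v = 0" if "metric X x *v v = 0" for v
  proof -
    have "?D v \<bullet> ?D v = v \<bullet> (metric X x *v v)"
      by (subst (1) D, subst (1) D) (simp add: metric_def matrix_vector_mult_def inner_vec_def 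
        inner_sum_left inner_sum_right sum_distrib_left mult_ac inner_commute)
    then have "?D v = ?D 0" using that linear_0[OF lin] by simp
    then show ?thesis using assms(2) by (simp add: inj_eq)
  qed
  then show ?thesis
    by (metis matrix_left_invertible_ker invertible_left_inverse)
qed

lemma mean_curvature_scaleR:
  fixes X :: "real^'n::finite \<Rightarrow> 'b::euclidean_space"
  assumes "open U" "x \<in> U" "smooth_immersion_on X U" "c > 0"
  shows "mean_curvature (\<lambda>y. c *\<^sub>R X y) N x = mean_curvature X N x / c"
proof -
  have "Ck_on (Suc (Suc 0)) X U" using assms(3) by (simp add: smooth_immersion_on_def smooth_on_def)
  then have d: "\<And>y. y \<in> U \<Longrightarrow> X differentiable (at y)"
    and dd: "\<And>y i. y \<in> U \<Longrightarrow> partial i X differentiable (at y)" by auto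
  have p: "partial i (\<lambda>y. c *\<^sub>R X y) y = c *\<^sub>R partial i X y" if "y \<in> U" for i y
    using partial_scaleR d that by blast
  have "second_ff (\<lambda>y. c *\<^sub>R X y) N i j x = c * second_ff X N i j x" for i j
    using partial_cong_open[OF assms(1,2), of "partial j (\<lambda>y. c *\<^sub>R X y)" "\<lambda>y. c *\<^sub>R partial j X y" i]
      partial_scaleR[OF dd[OF assms(2)]] by (simp add: second_ff_def p)
  moreover have "metric (\<lambda>y. c *\<^sub>R X y) x = c\<^sup>2 *\<^sub>R metric X x"
    using assms(2) by (simp add: metric_def p vec_eq_iff power2_eq_square)
  moreover have "invertible (metric X x)"
    using assms d by (auto intro!: metric_invertible simp: smooth_immersion_on_def)
  ultimately show ?thesis using assms(4)
    by (simp add: mean_curvature_def inv_metric_def matrix_inv_scaleR sum_divide_distrib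
        power2_eq_square field_simps)
qed

text \<open>The equivalent self-shrinker equation \<open>H = x\<^sup>\<bottom> / 2\<close>.\<close>

lemma self_shrinker_iff:
  fixes S :: "('p, 'n::finite, 'b::euclidean_space) hypersurface"
  assumes "immersed_hypersurface S"
  shows "self_shrinker S \<longleftrightarrow> (\<forall>(U, \<phi>)\<in>atlas S. \<forall>x\<in>U.
    mean_curvature (position S \<circ> \<phi>) (unit_normal S \<circ> \<phi>) x
      = (1/2) * (position S (\<phi> x) \<bullet> unit_normal S (\<phi> x)))"
proof -
  let ?H = "\<lambda>\<phi>. mean_curvature (position S \<circ> \<phi>) (unit_normal S \<circ> \<phi>)"
  have vd: "((\<lambda>s. sqrt (-s) *\<^sub>R a) has_vector_derivative (- (1 / (2 * sqrt (-t)))) *\<^sub>R a) (at t)"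
    if "t < 0" for t and a :: 'b
  proof -
    have "((\<lambda>s. sqrt (-s)) has_real_derivative (- (1 / (2 * sqrt (-t))))) (at t)"
      using that by (auto intro!: derivative_eq_intros simp: field_simps)
    from has_vector_derivative_scaleR[OF this has_vector_derivative_const[of a]] show ?thesis by simp
  qed
  have key: "(\<exists>v. ((\<lambda>s. sqrt (-s) *\<^sub>R position S (\<phi> x)) has_vector_derivative v) (at t) \<and>
            v \<bullet> unit_normal S (\<phi> x) =
              - mean_curvature (\<lambda>y. sqrt (-t) *\<^sub>R (position S \<circ> \<phi>) y) (unit_normal S \<circ> \<phi>) x)
      \<longleftrightarrow> ?H \<phi> x = (1/2) * (position S (\<phi> x) \<bullet> unit_normal S (\<phi> x))" (is "?L \<longleftrightarrow> ?R")
    if t: "t < 0" and m: "(U, \<phi>) \<in> atlas S" "x \<in> U" for t U \<phi> x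
  proof -
    have o: "open U" and im: "smooth_immersion_on (position S \<circ> \<phi>) U"
      using assms m by (auto simp: immersed_hypersurface_def smooth_atlas_def local_parametrization_def)
    have c: "sqrt (-t) > 0" using t by simp
    have "?L \<longleftrightarrow> ((- (1 / (2 * sqrt (-t)))) *\<^sub>R position S (\<phi> x)) \<bullet> unit_normal S (\<phi> x)
        = - (?H \<phi> x / sqrt (-t))"
      unfolding mean_curvature_scaleR[OF o m(2) im c]
      using vd[OF t] vector_derivative_unique_at by blast
    also have "\<dots> \<longleftrightarrow> ?R" using c by (auto simp: field_simps)
    finally show ?thesis .
  qed
  have "self_shrinker S \<longleftrightarrow> (\<forall>t<0. \<forall>(U, \<phi>)\<in>atlas S. \<forall>x\<in>U.
     (\<exists>v. ((\<lambda>s. sqrt (-s) *\<^sub>R position S (\<phi> x)) has_vector_derivative v) (at t) \<and>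
            v \<bullet> unit_normal S (\<phi> x) =
              - mean_curvature (\<lambda>y. sqrt (-t) *\<^sub>R (position S \<circ> \<phi>) y) (unit_normal S \<circ> \<phi>) x))"
    by (simp add: self_shrinker_def mean_curvature_flow_def rescale_def o_def Ball_def)
  also have "\<dots> \<longleftrightarrow> (\<forall>t<0::real. \<forall>(U, \<phi>)\<in>atlas S. \<forall>x\<in>U.
      ?H \<phi> x = (1/2) * (position S (\<phi> x) \<bullet> unit_normal S (\<phi> x)))"
    using key by (simp add: Ball_def split_paired_All) 
  also have "\<dots> \<longleftrightarrow> (\<forall>(U, \<phi>)\<in>atlas S. \<forall>x\<in>U.
      ?H \<phi> x = (1/2) * (position S (\<phi> x) \<bullet> unit_normal S (\<phi> x)))"
    using lt_ex[of "0::real"] by blast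
  finally show ?thesis .
qed

section \<open>Rotational symmetry and the cross-section\<close>

text \<open>The ambient space is \<open>complex \<times> (real^'m)\<close>; the first factor is the plane on which \<open>SO(2)\<close> acts,
  with \<open>r = norm w\<close>, and the rotations are the multiplications by \<open>cis \<alpha>\<close>.
  A hypersurface is invariant if its immersed image is; this is implied by any lifted
  action of \<open>SO(2)\<close> on the abstract manifold, so it is the weakest reading.\<close>

definition rotate :: "real \<Rightarrow> complex \<times> 'c \<Rightarrow> complex \<times> 'c" where
  "rotate \<alpha> = (\<lambda>(w, z). (cis \<alpha> * w, z))"

definition rotationally_symmetric ::
  "('p, 'n::finite, complex \<times> (real^'m::finite)) hypersurface \<Rightarrow> bool" where
  "rotationally_symmetric S \<longleftrightarrow>
     (\<forall>\<alpha>. rotate \<alpha> ` position S ` topspace (manifold S) = position S ` topspace (manifold S))"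

text \<open>The slice \<open>\<theta> = 0\<close>, an immersed hypersurface in the half-space with coordinates
  \<open>(r, z) :: real \<times> (real^'m)\<close>. Its atlas need not be related explicitly to that of \<open>S\<close>: its topology
  is the subspace topology, and the smooth structure making \<open>position \<Gamma>\<close> an immersion is then unique.
  Either choice of unit normal is allowed.\<close>

definition cross_section ::
  "('p, 'n::finite, complex \<times> (real^'m::finite)) hypersurface \<Rightarrow>
   ('p, 'm, real \<times> (real^'m)) hypersurface \<Rightarrow> bool" where
  "cross_section S \<Gamma> \<longleftrightarrow>
     immersed_hypersurface \<Gamma> \<and>
     manifold \<Gamma> = subtopology (manifold S) {p. \<exists>r\<ge>0. fst (position S p) = complex_of_real r} \<and>
     (\<forall>p\<in>topspace (manifold \<Gamma>).
        position \<Gamma> p = (norm (fst (position S p)), snd (position S p)))"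

section \<open>The weight and the stability operator\<close>

text \<open>Here \<open>n\<close> is the dimension of the rotationally symmetric hypersurface, and points of the
  half-space are pairs \<open>(r, z)\<close>.\<close>

definition sigma_weight :: "nat \<Rightarrow> real \<times> (real^'m::finite) \<Rightarrow> real" where
  "sigma_weight n x = 2 * pi / (4 * pi) powr (real n / 2) * fst x * exp (- (norm x)\<^sup>2 / 4)"

lemma inverse_sigma_weight:
  "inverse (sigma_weight n x) = ((4 * pi) powr (real n / 2) / (2 * pi)) / fst x * exp ((norm x)\<^sup>2 / 4)"
  by (simp add: sigma_weight_def exp_minus field_simps)

definition drift_laplacian ::
  "nat \<Rightarrow> (real^'m \<Rightarrow> real \<times> (real^'m::finite)) \<Rightarrow> (real^'m \<Rightarrow> real) \<Rightarrow> real^'m \<Rightarrow> real" where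
  "drift_laplacian n Y f y = inverse (sigma_weight n (Y y)) *
     surf_div Y (\<lambda>y'. sigma_weight n (Y y') *\<^sub>R surf_grad Y f y') y"

text \<open>The radial unit vector \<open>e\<^sub>r\<close> is \<open>(1, 0)\<close> in the half-space.\<close>

definition stability_op ::
  "nat \<Rightarrow> nat \<Rightarrow> (real^'m \<Rightarrow> real \<times> (real^'m::finite)) \<Rightarrow> (real^'m \<Rightarrow> real \<times> (real^'m)) \<Rightarrow>
   (real^'m \<Rightarrow> real) \<Rightarrow> real^'m \<Rightarrow> real" where
  "stability_op n k Y N f y = drift_laplacian n Y f y +
     (second_ff_norm_sq Y N y + (1 / (fst (Y y))\<^sup>2) * \<bar>(1, 0) \<bullet> N y\<bar>\<^sup>2 + 1 / 2
      - (real k)\<^sup>2 / (fst (Y y))\<^sup>2) * f y"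

end

theory Submission
  imports Defs
begin

text \<open>Put \<open>u = 1 / \<sigma>\<close>. Since \<open>\<sigma> grad u = - grad log \<sigma>\<close>, the drift Laplacian of \<open>u\<close> is \<open>u\<close> times the
  ordinary Laplacian of \<open>f = log u = |x|\<^sup>2 / 4 - log r + const\<close>. The Laplacian of the restriction to
  \<open>\<Gamma>\<close> of a function on the half-space is the tangential trace of its Hessian minus \<open>H\<close> times its normal
  derivative. Here the Hessian is \<open>id / 2 + e\<^sub>r e\<^sub>r / r\<^sup>2\<close>, and the normal derivative
  \<open>x\<^sup>\<bottom> / 2 - e\<^sub>r\<^sup>\<bottom> / r\<close> equals \<open>H\<close> by the shrinker equation of \<open>\<Gamma>\<close>, so with \<open>m = dim \<Gamma> = n - 1\<close>
  the Laplacian of \<open>f\<close> is \<open>m / 2 + (1 - |e\<^sub>r\<^sup>\<bottom>|\<^sup>2) / r\<^sup>2 - H\<^sup>2\<close>. In the operator with \<open>k = 1\<close> the terms with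
  \<open>1 / r\<^sup>2\<close> cancel, and \<open>n / 2 - (H\<^sup>2 - |A|\<^sup>2)\<close> remains. The Gauss equation identifies
  \<open>H\<^sup>2 - |A|\<^sup>2\<close> with the scalar curvature. These steps are \<open>surf_div_tangential_part\<close>,
  \<open>scalar_curvature_eq\<close> and \<open>stability_op_inverse_sigma_weight\<close>.

  It remains to derive the shrinker equation of \<open>\<Gamma>\<close> from that of \<open>\<Sigma>\<close>. Symmetry is only
  assumed of the image of \<open>\<Sigma>\<close>, so the first point is that the rotation field \<open>T\<close> is tangent to every
  sheet (\<open>rotation_field_tangent\<close>): if it were transverse to a sheet at some point, the rotated copies of that
  sheet would fill an open set, whereas the image of a compact hypersurface has measure zero.
  Since \<open>T\<close> is tangent and depends linearly on the position \<open>x\<close>, its derivative along itself is \<open>T\<^sup>2 x\<close>, so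
  \<open>A(T, T) = \<langle>T\<^sup>2 x, N\<rangle> = - r \<langle>e\<^sub>r, N\<rangle>\<close>. At a point of the slice the tangent space of \<open>\<Sigma>\<close> is the orthogonal
  sum of \<open>T\<close> and the tangent space of \<open>\<Gamma>\<close>, the normals agree up to sign, and on the latter summand the
  two second fundamental forms agree, because the inclusion of \<open>\<Gamma>\<close> lifts to a differentiable map into the
  charts of \<open>\<Sigma>\<close>. Taking traces gives \<open>H\<^sub>\<Sigma> = H\<^sub>\<Gamma> + \<langle>e\<^sub>r, N\<rangle> / r\<close>
  (\<open>mean_curvature_cross_section\<close>).\<close>

section \<open>Partial derivatives\<close>

lemma partial_eqI: "(f has_derivative D) (at x) \<Longrightarrow> partial i f x = D (axis i 1)"
  by (simp add: partial_def frechet_derivative_at[symmetric])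

lemma has_derivative_frechet:
  "f differentiable (at x) \<Longrightarrow> (f has_derivative frechet_derivative f (at x)) (at x)"
  by (simp add: frechet_derivative_works)

lemma frechet_derivative_eq_sum_partial:
  fixes f :: "real^'n::finite \<Rightarrow> 'b::real_normed_vector"
  assumes "f differentiable (at x)"
  shows "frechet_derivative f (at x) v = (\<Sum>i\<in>UNIV. v $ i *\<^sub>R partial i f x)"
proof -
  have lin: "linear (frechet_derivative f (at x))"
    using assms by (rule linear_frechet_derivative)
  have "frechet_derivative f (at x) v = frechet_derivative f (at x) (\<Sum>i\<in>UNIV. v $ i *\<^sub>R axis i 1)"
    using basis_expansion[of v] by (simp add: scalar_mult_eq_scaleR)
  then show ?thesis
    by (simp add: linear_sum[OF lin] linear_cmul[OF lin] partial_def o_def)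
qed

lemma partial_diff:
  assumes "f differentiable (at x)" "g differentiable (at x)"
  shows "partial i (\<lambda>y. f y - g y) x = partial i f x - partial i g x"
  by (rule partial_eqI[OF has_derivative_diff[OF assms[THEN has_derivative_frechet]],
        folded partial_def])

lemma partial_sum:
  assumes "\<And>a. a \<in> I \<Longrightarrow> f a differentiable (at x)"
  shows "partial i (\<lambda>y. \<Sum>a\<in>I. f a y) x = (\<Sum>a\<in>I. partial i (f a) x)"
  by (rule partial_eqI[OF has_derivative_sum[OF assms[THEN has_derivative_frechet]],
        folded partial_def])

lemma partial_const: "partial i (\<lambda>y. c) x = 0"
  by (rule partial_eqI[OF has_derivative_const])

lemma partial_scaleR_fun:
  assumes "f differentiable (at x)" "g differentiable (at x)"
  shows "partial i (\<lambda>y. f y *\<^sub>R g y) x = f x *\<^sub>R partial i g x + partial i f x *\<^sub>R g x"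
  by (rule partial_eqI[OF has_derivative_scaleR[OF assms[THEN has_derivative_frechet]],
        folded partial_def])

lemma partial_inner:
  fixes f g :: "real^'n::finite \<Rightarrow> 'b::real_inner"
  assumes "f differentiable (at x)" "g differentiable (at x)"
  shows "partial i (\<lambda>y. f y \<bullet> g y) x = f x \<bullet> partial i g x + partial i f x \<bullet> g x"
  by (rule partial_eqI[OF has_derivative_inner[OF assms[THEN has_derivative_frechet]],
        folded partial_def])

lemma partial_bounded_linear:
  assumes "bounded_linear B" "f differentiable (at x)"
  shows "partial i (\<lambda>y. B (f y)) x = B (partial i f x)"
  by (rule partial_eqI[OF bounded_linear.has_derivative[OF assms(1)
        has_derivative_frechet[OF assms(2)]], folded partial_def])

lemma differentiable_bounded_linear:
  assumes "bounded_linear B" "f differentiable F"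
  shows "(\<lambda>y. B (f y)) differentiable F"
  using bounded_linear.has_derivative[OF assms(1)] assms(2) unfolding differentiable_def by fast

lemma partial_compose:
  fixes c :: "real^'k::finite \<Rightarrow> real^'n::finite" and f :: "real^'n \<Rightarrow> 'b::real_normed_vector"
  assumes "c differentiable (at x)" "f differentiable (at (c x))"
  shows "partial i (\<lambda>y. f (c y)) x = (\<Sum>a\<in>UNIV. partial i c x $ a *\<^sub>R partial a f (c x))"
proof -
  have "((\<lambda>y. f (c y)) has_derivative
      (\<lambda>v. frechet_derivative f (at (c x)) (frechet_derivative c (at x) v))) (at x)"
    by (rule has_derivative_compose[OF assms[THEN has_derivative_frechet]])
  from partial_eqI[OF this] show ?thesis
    unfolding partial_def[of i c] frechet_derivative_eq_sum_partial[OF assms(2)] .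
qed

lemma differentiable_sum_fun:
  assumes "\<And>a. a \<in> I \<Longrightarrow> f a differentiable F" 
  shows "(\<lambda>y. \<Sum>a\<in>I. f a y) differentiable F"
proof -
  have "\<exists>D. \<forall>a\<in>I. (f a has_derivative D a) F"
    using assms unfolding differentiable_def by (intro bchoice) blast
  then show ?thesis
    unfolding differentiable_def by (blast intro: has_derivative_sum)
qed

lemma differentiable_prod_fun:
  fixes f :: "'i \<Rightarrow> 'a::real_normed_vector \<Rightarrow> real"
  assumes "\<And>a. a \<in> I \<Longrightarrow> f a differentiable (at x)"
  shows "(\<lambda>y. \<Prod>a\<in>I. f a y) differentiable (at x)"
proof -
  have "\<exists>D. \<forall>a\<in>I. (f a has_derivative D a) (at x)"
    using assms unfolding differentiable_def by (intro bchoice) blast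
  then show ?thesis
    unfolding differentiable_def by (blast intro: has_derivative_prod)
qed

lemma differentiable_scaleR_fun:
  assumes "f differentiable (at x)" "g differentiable (at x)"
  shows "(\<lambda>y. f y *\<^sub>R g y) differentiable (at x)"
  using has_derivative_scaleR[OF assms[THEN has_derivative_frechet]] by (rule differentiableI)

lemma differentiable_inner_fun:
  fixes f g :: "'a::real_normed_vector \<Rightarrow> 'b::real_inner"
  assumes "f differentiable (at x)" "g differentiable (at x)"
  shows "(\<lambda>y. f y \<bullet> g y) differentiable (at x)"
  using has_derivative_inner[OF assms[THEN has_derivative_frechet]] by (rule differentiableI)

lemma differentiable_cong_open:
  assumes "open U" "x \<in> U" "\<And>y. y \<in> U \<Longrightarrow> f y = g y"
  shows "f differentiable (at x) \<longleftrightarrow> g differentiable (at x)"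
proof -
  have "(f has_derivative D) (at x) \<longleftrightarrow> (g has_derivative D) (at x)" for D
    using assms by (metis has_derivative_transform_within_open)
  then show ?thesis by (simp add: differentiable_def)
qed

lemma smooth_on_imp_differentiable:
  "smooth_on f U \<Longrightarrow> x \<in> U \<Longrightarrow> f differentiable (at x)"
  unfolding smooth_on_def by (metis Ck_on.simps(2))

lemma smooth_on_imp_continuous_on: "smooth_on f U \<Longrightarrow> continuous_on U f"
  unfolding smooth_on_def by (metis Ck_on.simps(1))

lemma smooth_on_partial: "smooth_on f U \<Longrightarrow> smooth_on (partial i f) U"
  unfolding smooth_on_def by (metis Ck_on.simps(2))

lemma has_real_derivative_along_axis:
  fixes f :: "real^'n::finite \<Rightarrow> real"
  assumes "f differentiable (at (x + s *\<^sub>R axis i 1))"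
  shows "((\<lambda>s. f (x + s *\<^sub>R axis i 1)) has_real_derivative partial i f (x + s *\<^sub>R axis i 1)) (at s)"
proof -
  let ?D = "frechet_derivative f (at (x + s *\<^sub>R axis i 1))"
  have "((\<lambda>s. f (x + s *\<^sub>R axis i 1)) has_derivative (\<lambda>h. ?D (h *\<^sub>R axis i 1))) (at s)"
    by (rule has_derivative_compose[of "\<lambda>s. x + s *\<^sub>R axis i 1"])
      (auto intro!: derivative_eq_intros simp: assms frechet_derivative_works[symmetric])
  moreover have "?D (h *\<^sub>R axis i 1) = partial i f (x + s *\<^sub>R axis i 1) * h" for h
    using linear_cmul[OF linear_frechet_derivative[OF assms]] by (simp add: partial_def)
  ultimately show ?thesis
    by (simp add: has_field_derivative_def)
qed

text \<open>The mean value theorem in one direction and then in the other. The left-hand side is symmetric in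
  \<open>i\<close> and \<open>j\<close>, which is what makes the mixed partial derivatives commute.\<close>

lemma second_difference_eq_mixed_partial:
  fixes f :: "real^'n::finite \<Rightarrow> real"
  assumes h: "0 < h" "2 * h < d"
    and f: "\<And>y. y \<in> ball x d \<Longrightarrow> f differentiable (at y)"
    and pf: "\<And>y. y \<in> ball x d \<Longrightarrow> partial i f differentiable (at y)"
  shows "\<exists>\<xi>\<in>ball x d. f (x + h *\<^sub>R axis i 1 + h *\<^sub>R axis j 1) - f (x + h *\<^sub>R axis i 1)
    - f (x + h *\<^sub>R axis j 1) + f x = h\<^sup>2 * partial j (partial i f) \<xi>"
proof -
  have inb: "x + s *\<^sub>R axis i 1 + t *\<^sub>R axis j 1 \<in> ball x d"
    if "0 \<le> s" "s \<le> h" "0 \<le> t" "t \<le> h" for s t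
  proof -
    have "norm (s *\<^sub>R axis i 1 + t *\<^sub>R axis j (1::real)) \<le> s + t"
      using norm_triangle_ineq[of "s *\<^sub>R axis i (1::real)" "t *\<^sub>R axis j 1"] that by simp
    moreover have "dist x (x + s *\<^sub>R axis i 1 + t *\<^sub>R axis j 1) = norm (s *\<^sub>R axis i 1 + t *\<^sub>R axis j (1::real))"
      by (metis add.assoc add_diff_cancel_left' dist_commute dist_norm)
    ultimately show ?thesis using that h by simp
  qed
  let ?p = "\<lambda>s. f ((x + h *\<^sub>R axis j 1) + s *\<^sub>R axis i 1) - f (x + s *\<^sub>R axis i 1)"
  let ?p' = "\<lambda>s. partial i f ((x + h *\<^sub>R axis j 1) + s *\<^sub>R axis i 1) - partial i f (x + s *\<^sub>R axis i 1)"
  have "\<exists>s>0. s < h \<and> ?p h - ?p 0 = (h - 0) * ?p' s"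
  proof (rule MVT2[OF h(1)])
    fix s assume "0 \<le> s" "s \<le> h"
    then show "(?p has_real_derivative ?p' s) (at s)"
      using inb[of s h] inb[of s 0] h
      by (intro DERIV_diff has_real_derivative_along_axis f) (simp_all add: add_ac)
  qed
  then obtain s where s: "0 < s" "s < h" "?p h - ?p 0 = h * ?p' s" by auto
  let ?q = "\<lambda>t. partial i f ((x + s *\<^sub>R axis i 1) + t *\<^sub>R axis j 1)"
  have "\<exists>t>0. t < h \<and> ?q h - ?q 0
    = (h - 0) * partial j (partial i f) ((x + s *\<^sub>R axis i 1) + t *\<^sub>R axis j 1)"
  proof (rule MVT2[OF h(1)])
    fix t assume "0 \<le> t" "t \<le> h"
    then show "(?q has_real_derivative partial j (partial i f) ((x + s *\<^sub>R axis i 1) + t *\<^sub>R axis j 1)) (at t)"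
      using inb[of s t] s by (intro has_real_derivative_along_axis pf) auto
  qed
  then obtain t where t: "0 < t" "t < h" "?q h - ?q 0
    = h * partial j (partial i f) ((x + s *\<^sub>R axis i 1) + t *\<^sub>R axis j 1)" by auto
  have swap: "x + a + b = x + b + a" for a b :: "real^'n" by (simp add: add_ac)
  have "?p h - ?p 0 = h * (?q h - ?q 0)"
    unfolding s(3) by (subst swap) simp
  then have "?p h - ?p 0 = h\<^sup>2 * partial j (partial i f) (x + s *\<^sub>R axis i 1 + t *\<^sub>R axis j 1)"
    using t(3) by (simp add: power2_eq_square)
  then show ?thesis
    using inb[of s t] s(1,2) t(1,2)
    by (intro bexI[of _ "x + s *\<^sub>R axis i 1 + t *\<^sub>R axis j 1"])
      (simp_all add: swap[of "h *\<^sub>R axis i 1" "h *\<^sub>R axis j 1"])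
qed

lemma partial_commute_real:
  fixes f :: "real^'n::finite \<Rightarrow> real"
  assumes U: "open U" "x \<in> U" and C2: "Ck_on (Suc (Suc 0)) f U"
  shows "partial i (partial j f) x = partial j (partial i f) x"
proof (rule ccontr)
  let ?a = "partial i (partial j f)" and ?b = "partial j (partial i f)"
  assume "?a x \<noteq> ?b x"
  define e where "e = \<bar>?a x - ?b x\<bar> / 2"
  have e: "e > 0" using \<open>?a x \<noteq> ?b x\<close> by (simp add: e_def)
  have ev: "\<forall>\<^sub>F y in nhds x. g y \<in> ball (g x) e" if "continuous_on U g" for g :: "real^'n \<Rightarrow> real"
  proof -
    have "isCont g x" using U that by (simp add: continuous_on_eq_continuous_at)
    then have "filterlim g (nhds (g x)) (nhds x)" by (simp add: isCont_def tendsto_at_iff_tendsto_nhds)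
    then show ?thesis using e by (intro topological_tendstoD) auto
  qed
  have cont: "continuous_on U ?a" "continuous_on U ?b" using C2 by simp_all
  have "\<forall>\<^sub>F y in nhds x. y \<in> U \<and> ?a y \<in> ball (?a x) e \<and> ?b y \<in> ball (?b x) e"
    using U cont[THEN ev] by (intro eventually_conj eventually_nhds_in_open)
  then obtain d where d: "d > 0"
    "\<And>y. dist y x < d \<Longrightarrow> y \<in> U \<and> ?a y \<in> ball (?a x) e \<and> ?b y \<in> ball (?b x) e"
    unfolding eventually_nhds_metric by blast
  have *: "f differentiable (at y)" "partial k f differentiable (at y)" if "y \<in> ball x d" for y k
    using d(2)[of y] that C2 by (auto simp: dist_commute)
  define h where "h = d / 3"
  have h: "0 < h" "2 * h < d" using d(1) by (auto simp: h_def)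
  obtain \<xi> where \<xi>: "\<xi> \<in> ball x d" "f (x + h *\<^sub>R axis i 1 + h *\<^sub>R axis j 1) - f (x + h *\<^sub>R axis i 1)
    - f (x + h *\<^sub>R axis j 1) + f x = h\<^sup>2 * ?b \<xi>"
    using second_difference_eq_mixed_partial[OF h *(1) *(2)[of _ i], where j=j] by blast
  obtain \<eta> where \<eta>: "\<eta> \<in> ball x d" "f (x + h *\<^sub>R axis j 1 + h *\<^sub>R axis i 1) - f (x + h *\<^sub>R axis j 1)
    - f (x + h *\<^sub>R axis i 1) + f x = h\<^sup>2 * ?a \<eta>"
    using second_difference_eq_mixed_partial[OF h *(1) *(2)[of _ j], where j=i] by blast
  have swap: "x + h *\<^sub>R axis j 1 + h *\<^sub>R axis i 1 = x + h *\<^sub>R axis i 1 + h *\<^sub>R axis j 1"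
    by (simp add: add_ac)
  have "h\<^sup>2 * ?a \<eta> = h\<^sup>2 * ?b \<xi>" using \<xi>(2) \<eta>(2) unfolding swap by linarith
  then have "?a \<eta> = ?b \<xi>" using h(1) by simp
  moreover have "\<bar>?a \<eta> - ?a x\<bar> < e" "\<bar>?b \<xi> - ?b x\<bar> < e"
    using d(2)[of \<xi>] d(2)[of \<eta>] \<xi>(1) \<eta>(1) by (auto simp: dist_commute dist_real_def)
  ultimately show False unfolding e_def by (auto simp: abs_if field_simps split: if_splits)
qed

lemma partial_commute:
  fixes f :: "real^'n::finite \<Rightarrow> 'b::euclidean_space"
  assumes U: "open U" "x \<in> U" and f: "smooth_on f U"
  shows "partial i (partial j f) x = partial j (partial i f) x"
proof (rule euclidean_eqI)
  fix b :: 'b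
  have p: "partial k (\<lambda>y. g y \<bullet> b) y = partial k g y \<bullet> b"
    if "smooth_on g U" "y \<in> U" for k y and g :: "real^'n \<Rightarrow> 'b"
    by (rule partial_bounded_linear[OF bounded_linear_inner_left smooth_on_imp_differentiable[OF that]])
  have pp: "partial k (partial l (\<lambda>y. f y \<bullet> b)) y = partial k (partial l f) y \<bullet> b"
    if "y \<in> U" for k l y
    using partial_cong_open[OF U(1) that p[OF f]] p[OF smooth_on_partial[OF f] that] by simp
  have d: "(\<lambda>y. g y \<bullet> b) differentiable (at y)" if "smooth_on g U" "y \<in> U"
    for y and g :: "real^'n \<Rightarrow> 'b"
    by (rule differentiable_bounded_linear[OF bounded_linear_inner_left smooth_on_imp_differentiable[OF that]])
  have "partial l (\<lambda>y. f y \<bullet> b) differentiable (at y)" if "y \<in> U" for l y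
    by (subst differentiable_cong_open[OF U(1) that p[OF f]])
      (auto intro: d[OF smooth_on_partial[OF f] that])
  moreover have "continuous_on U (partial k (partial l (\<lambda>y. f y \<bullet> b)))" for k l
  proof -
    have "continuous_on U (\<lambda>y. partial k (partial l f) y \<bullet> b)"
      by (intro continuous_intros smooth_on_imp_continuous_on smooth_on_partial f)
    then show ?thesis using pp by (simp cong: continuous_on_cong)
  qed
  ultimately have "Ck_on (Suc (Suc 0)) (\<lambda>y. f y \<bullet> b) U"
    using d[OF f] by simp
  from partial_commute_real[OF U this] show "partial i (partial j f) x \<bullet> b = partial j (partial i f) x \<bullet> b"
    by (simp add: pp U)
qed

section \<open>The coordinate frame of an immersed hypersurface\<close>

lemma matrix_inv_mult:
  fixes M :: "real^'n^'n"
  assumes "invertible M"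
  shows "matrix_inv M ** M = mat 1" and "M ** matrix_inv M = mat 1"
proof -
  have "M ** matrix_inv M = mat 1 \<and> matrix_inv M ** M = mat 1"
    using assms unfolding invertible_def matrix_inv_def by (rule someI_ex)
  then show "matrix_inv M ** M = mat 1" "M ** matrix_inv M = mat 1" by auto
qed

text \<open>The normal is a pointwise choice. Whenever a normal part has to be differentiated, it is written as
  an ambient field minus its tangential part.\<close>

locale immersed_patch =
  fixes V :: "(real^'n::finite) set" and Y N :: "real^'n \<Rightarrow> 'b::euclidean_space"
  assumes open_V: "open V"
    and immersion: "smooth_immersion_on Y V"
    and codim: "DIM('b) = CARD('n) + 1"
    and norm_N: "y \<in> V \<Longrightarrow> norm (N y) = 1"
    and tangent_normal: "y \<in> V \<Longrightarrow> partial i Y y \<bullet> N y = 0"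
begin

abbreviation "E \<equiv> \<lambda>i. partial i Y"
abbreviation "G \<equiv> \<lambda>i j y. inv_metric Y y $ i $ j"
abbreviation "A \<equiv> second_ff Y N"
abbreviation "\<Gamma> \<equiv> christoffel Y"

lemma smooth: "smooth_on Y V"
  using immersion by (simp add: smooth_immersion_on_def)

lemma differentiable_Y: "y \<in> V \<Longrightarrow> Y differentiable (at y)"
  and differentiable_E: "y \<in> V \<Longrightarrow> E i differentiable (at y)"
  and differentiable_dE: "y \<in> V \<Longrightarrow> partial j (E i) differentiable (at y)"
  by (auto intro: smooth_on_imp_differentiable smooth_on_partial smooth)

lemma E_commute: "y \<in> V \<Longrightarrow> partial i (E j) y = partial j (E i) y"
  by (rule partial_commute[OF open_V _ smooth])

lemma second_ff_commute: "y \<in> V \<Longrightarrow> A i j y = A j i y"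
  by (simp add: second_ff_def E_commute)

lemma N_inner_N: "y \<in> V \<Longrightarrow> N y \<bullet> N y = 1"
  by (simp add: dot_square_norm norm_N)

lemma invertible_metric: "y \<in> V \<Longrightarrow> invertible (metric Y y)"
  using immersion by (intro metric_invertible differentiable_Y) (auto simp: smooth_immersion_on_def)

lemma G_metric:
  assumes "y \<in> V"
  shows "(\<Sum>l\<in>UNIV. G k l y * (E l y \<bullet> E j y)) = (if k = j then 1 else 0)"
proof -
  have "inv_metric Y y ** metric Y y = mat 1"
    unfolding inv_metric_def by (rule matrix_inv_mult(1)[OF invertible_metric[OF assms]])
  then have "(inv_metric Y y ** metric Y y) $ k $ j = mat 1 $ k $ j" by simp
  then show ?thesis by (simp add: matrix_matrix_mult_def metric_def mat_def)
qed

lemma G_symmetric: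
  assumes "y \<in> V"
  shows "G i j y = G j i y"
proof -
  let ?M = "metric Y y" and ?G = "inv_metric Y y"
  have T: "transpose ?M = ?M"
    by (simp add: transpose_def metric_def vec_eq_iff inner_commute)
  have 1: "?G ** ?M = mat 1" "?M ** ?G = mat 1"
    using invertible_metric[OF assms] by (simp_all add: inv_metric_def matrix_inv_mult)
  have "transpose (?M ** ?G) = transpose ?G ** transpose ?M"
    by (rule matrix_transpose_mul)
  then have "transpose ?G ** ?M = mat 1"
    using 1 T by (simp add: transpose_mat)
  then have "transpose ?G ** ?M ** ?G = ?G" by simp
  then have "transpose ?G = ?G"
    by (simp only: matrix_mul_assoc[symmetric] 1 matrix_mul_rid)
  then have "transpose ?G $ j $ i = ?G $ j $ i" by simp
  then show ?thesis by (simp add: transpose_def)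
qed

text \<open>The components, in the coordinate frame, of the tangential part of an ambient vector.\<close>

definition coord :: "real^'n \<Rightarrow> 'b \<Rightarrow> 'n \<Rightarrow> real" where
  "coord y v k = (\<Sum>l\<in>UNIV. G k l y * (v \<bullet> E l y))"

lemma coord_inner_E:
  assumes "y \<in> V"
  shows "(\<Sum>k\<in>UNIV. coord y v k * (E k y \<bullet> E j y)) = v \<bullet> E j y"
proof -
  have "(\<Sum>k\<in>UNIV. coord y v k * (E k y \<bullet> E j y))
    = (\<Sum>l\<in>UNIV. (v \<bullet> E l y) * (\<Sum>k\<in>UNIV. G l k y * (E k y \<bullet> E j y)))"
    unfolding coord_def sum_distrib_left sum_distrib_right
    by (subst sum.swap) (simp add: G_symmetric[OF assms] mult_ac)
  also have "\<dots> = v \<bullet> E j y"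
    by (simp add: G_metric[OF assms] if_distrib cong: if_cong)
  finally show ?thesis .
qed

text \<open>The hypothesis of codimension one enters here: the tangent space and \<open>w\<^sup>\<bottom>\<close> would have the same
  dimension, hence coincide, and then \<open>N\<close> would be both tangent and normal.\<close>

lemma orthogonal_to_hypersurface_imp_zero:
  assumes y: "y \<in> V" and E: "\<And>i. w \<bullet> E i y = 0" and N: "w \<bullet> N y = 0"
  shows "w = 0"
proof (rule ccontr)
  assume "w \<noteq> 0"
  let ?D = "frechet_derivative Y (at y)"
  have D: "linear ?D" "inj ?D"
    using y immersion differentiable_Y by (auto intro: linear_frechet_derivative simp: smooth_immersion_on_def)
  have Dv: "?D v = (\<Sum>i\<in>UNIV. v $ i *\<^sub>R E i y)" for v
    by (rule frechet_derivative_eq_sum_partial[OF differentiable_Y[OF y]])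
  have "range ?D = {x. w \<bullet> x = 0}"
  proof (rule subspace_dim_equal)
    show "subspace (range ?D)" using D(1) by (simp add: linear_subspace_image)
    show "subspace {x. w \<bullet> x = 0}" by (rule subspace_hyperplane)
    show "range ?D \<subseteq> {x. w \<bullet> x = 0}" by (auto simp: Dv inner_sum_right E)
    show "dim (range ?D) \<ge> dim {x. w \<bullet> x = 0}"
      using dim_image_eq[OF D(1), of UNIV] D(2) dim_hyperplane[OF \<open>w \<noteq> 0\<close>] codim
      by (simp add: inj_on_subset)
  qed
  then obtain v where "N y = ?D v" using N by blast
  then have "N y \<bullet> N y = (\<Sum>i\<in>UNIV. v $ i *\<^sub>R E i y) \<bullet> N y" using Dv by simp
  also have "\<dots> = 0" by (simp only: inner_sum_left inner_scaleR_left tangent_normal[OF y]) simp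
  finally have "N y \<bullet> N y = 0" .
  then show False using N_inner_N[OF y] by simp
qed

lemma frame_expansion:
  assumes y: "y \<in> V"
  shows "v = (\<Sum>k\<in>UNIV. coord y v k *\<^sub>R E k y) + (v \<bullet> N y) *\<^sub>R N y"
proof -
  have "v - ((\<Sum>k\<in>UNIV. coord y v k *\<^sub>R E k y) + (v \<bullet> N y) *\<^sub>R N y) = 0"
    by (rule orthogonal_to_hypersurface_imp_zero[OF y])
      (simp_all add: inner_diff_left inner_add_left inner_sum_left coord_inner_E[OF y]
        tangent_normal[OF y] inner_commute[of "N y" "partial _ _ _"] N_inner_N[OF y])
  then show ?thesis by simp
qed

text \<open>Parseval's identity for the frame consisting of the coordinate fields and the normal.\<close>

lemma frame_inner:
  assumes y: "y \<in> V"
  shows "v \<bullet> w = (\<Sum>k\<in>UNIV. coord y v k * (w \<bullet> E k y)) + (v \<bullet> N y) * (w \<bullet> N y)"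
  by (subst (1) frame_expansion[OF y, of v])
    (simp add: inner_add_left inner_sum_left inner_commute[of w])

lemma metric_trace:
  assumes "y \<in> V"
  shows "(\<Sum>i\<in>UNIV. \<Sum>j\<in>UNIV. G i j y * (E i y \<bullet> E j y)) = real CARD('n)"
proof -
  have "(\<Sum>i\<in>UNIV. \<Sum>j\<in>UNIV. G i j y * (E i y \<bullet> E j y)) = (\<Sum>i\<in>UNIV. \<Sum>j\<in>UNIV. G i j y * (E j y \<bullet> E i y))"
    by (simp add: inner_commute)
  then show ?thesis by (simp add: G_metric[OF assms])
qed

lemma differentiable_metric: "y \<in> V \<Longrightarrow> (\<lambda>y. E i y \<bullet> E j y) differentiable (at y)"
  by (intro differentiable_inner_fun differentiable_E)

text \<open>Cramer's rule expresses the entries of the inverse metric as quotients of polynomials in the metric.\<close>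

lemma differentiable_G:
  assumes "y \<in> V"
  shows "G k l differentiable (at y)"
proof -
  let ?B = "\<lambda>y. \<chi> i j. if j = k then axis l 1 $ i else metric Y y $ i $ j"
  have eq: "G k l z = det (?B z) * inverse (det (metric Y z))" if "z \<in> V" for z
  proof -
    have inv: "invertible (metric Y z)" by (rule invertible_metric[OF that])
    have det0: "det (metric Y z) \<noteq> 0" using inv by (simp add: invertible_det_nz)
    have "metric Y z *v (inv_metric Y z *v axis l 1) = axis l 1"
      by (simp add: matrix_vector_mul_assoc inv_metric_def matrix_inv_mult[OF inv])
    then have "inv_metric Y z *v axis l 1
        = (\<chi> k. det (\<chi> i j. if j = k then axis l 1 $ i else metric Y z $ i $ j) / det (metric Y z))"
      by (rule iffD1[OF cramer[OF det0]])
    then have "(inv_metric Y z *v axis l 1) $ k = det (?B z) / det (metric Y z)" by simp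
    moreover have "(inv_metric Y z *v axis l 1) $ k = G k l z"
      by (simp add: matrix_vector_mult_def axis_def if_distrib cong: if_cong)
    ultimately show ?thesis by (simp add: divide_inverse)
  qed
  have det: "(\<lambda>z. det (M z)) differentiable (at y)"
    if "\<And>i j. (\<lambda>z. M z $ i $ j) differentiable (at y)" for M :: "real^'n \<Rightarrow> real^'n^'n"
    unfolding det_def
    by (intro differentiable_sum_fun differentiable_mult differentiable_const differentiable_prod_fun that)
  have m: "(\<lambda>z. metric Y z $ i $ j) differentiable (at y)" for i j
    using differentiable_metric[OF assms] by (simp add: metric_def)
  have "(\<lambda>z. det (?B z)) differentiable (at y)"
  proof (rule det)
    fix i j
    show "(\<lambda>z. ?B z $ i $ j) differentiable (at y)"
      by (cases "j = k") (simp_all add: m)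
  qed
  moreover have "(\<lambda>z. inverse (det (metric Y z))) differentiable (at y)"
    by (intro differentiable_inverse det m) (use invertible_metric[OF assms] in \<open>simp add: invertible_det_nz\<close>)
  ultimately show ?thesis
    by (subst differentiable_cong_open[OF open_V assms eq]) (auto intro: differentiable_mult)
qed

lemma partial_metric:
  assumes "y \<in> V"
  shows "partial i (\<lambda>y. metric Y y $ j $ l) y = E j y \<bullet> partial i (E l) y + partial i (E j) y \<bullet> E l y"
  using partial_inner[OF differentiable_E[OF assms] differentiable_E[OF assms], of i j l]
  by (simp add: metric_def)

text \<open>The Levi-Civita connection of an induced metric is the tangential part of the ambient derivative.
  In this form Christoffel symbols are available without derivatives of the metric.\<close>

lemma christoffel_eq_coord:
  assumes y: "y \<in> V"
  shows "\<Gamma> k i j y = coord y (partial i (E j) y) k"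
proof -
  have "partial i (\<lambda>y. metric Y y $ j $ l) y + partial j (\<lambda>y. metric Y y $ i $ l) y
      - partial l (\<lambda>y. metric Y y $ i $ j) y = 2 * (partial i (E j) y \<bullet> E l y)" for l
    using E_commute[OF y, of j i] E_commute[OF y, of l i] E_commute[OF y, of l j]
    by (simp add: partial_metric[OF y] inner_commute)
  then show ?thesis
    by (simp add: christoffel_def coord_def sum_distrib_left)
qed

lemma differentiable_coord:
  assumes "y \<in> V" "v differentiable (at y)"
  shows "(\<lambda>y. coord y (v y) k) differentiable (at y)"
  unfolding coord_def
  by (intro differentiable_sum_fun differentiable_mult differentiable_G differentiable_inner_fun
      differentiable_E assms)

lemma differentiable_christoffel:
  assumes "y \<in> V"
  shows "\<Gamma> k i j differentiable (at y)"
  using differentiable_coord[OF assms differentiable_dE[OF assms]]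
    differentiable_cong_open[OF open_V assms, of "\<Gamma> k i j" "\<lambda>z. coord z (partial i (E j) z) k"]
  by (simp add: christoffel_eq_coord)

lemma gauss_formula:
  assumes y: "y \<in> V"
  shows "partial i (E j) y = (\<Sum>k\<in>UNIV. \<Gamma> k i j y *\<^sub>R E k y) + A i j y *\<^sub>R N y"
  using frame_expansion[OF y, of "partial i (E j) y"]
  by (simp add: christoffel_eq_coord[OF y] second_ff_def)

lemma christoffel_lower:
  assumes "y \<in> V"
  shows "(\<Sum>k\<in>UNIV. \<Gamma> k i j y * (E k y \<bullet> E l y)) = partial i (E j) y \<bullet> E l y"
  by (simp add: christoffel_eq_coord[OF assms] coord_inner_E[OF assms])

end

section \<open>The Gauss equation and the divergence of a tangential part\<close>

lemma sum_rotate4: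
  "(\<Sum>j\<in>J. \<Sum>k\<in>K. \<Sum>i\<in>I. \<Sum>m\<in>M. f i k m j) = (\<Sum>i\<in>I. \<Sum>k\<in>K. \<Sum>m\<in>M. \<Sum>j\<in>J. f i k m j)"
proof -
  have "(\<Sum>j\<in>J. \<Sum>k\<in>K. \<Sum>i\<in>I. \<Sum>m\<in>M. f i k m j) = (\<Sum>j\<in>J. \<Sum>i\<in>I. \<Sum>k\<in>K. \<Sum>m\<in>M. f i k m j)"
    by (intro sum.cong refl sum.swap)
  also have "\<dots> = (\<Sum>i\<in>I. \<Sum>j\<in>J. \<Sum>k\<in>K. \<Sum>m\<in>M. f i k m j)"
    by (rule sum.swap)
  also have "\<dots> = (\<Sum>i\<in>I. \<Sum>k\<in>K. \<Sum>j\<in>J. \<Sum>m\<in>M. f i k m j)"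
    by (intro sum.cong refl sum.swap)
  also have "\<dots> = (\<Sum>i\<in>I. \<Sum>k\<in>K. \<Sum>m\<in>M. \<Sum>j\<in>J. f i k m j)"
    by (intro sum.cong refl sum.swap)
  finally show ?thesis .
qed

context immersed_patch
begin

lemma coord_add: "coord y (v + w) k = coord y v k + coord y w k"
  by (simp add: coord_def inner_add_left sum.distrib algebra_simps)

lemma coord_scaleR: "coord y (a *\<^sub>R v) k = a * coord y v k"
  by (simp add: coord_def sum_distrib_left mult_ac)

lemma coord_sum: "coord y (\<Sum>a\<in>I. v a) k = (\<Sum>a\<in>I. coord y (v a) k)"
  unfolding coord_def by (subst sum.swap) (simp add: inner_sum_left sum_distrib_left)

lemma coord_E: "y \<in> V \<Longrightarrow> coord y (E j y) k = (if k = j then 1 else 0)"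
  using G_metric[of y k j] by (simp add: coord_def inner_commute)

lemma raise_index:
  assumes "y \<in> V"
  shows "(\<Sum>m\<in>UNIV. G k m y * (\<Sum>l\<in>UNIV. r l * (E l y \<bullet> E m y))) = r k"
proof -
  have "(\<Sum>m\<in>UNIV. G k m y * (\<Sum>l\<in>UNIV. r l * (E l y \<bullet> E m y))) = coord y (\<Sum>l\<in>UNIV. r l *\<^sub>R E l y) k"
    by (simp add: coord_def inner_sum_left)
  then show ?thesis
    by (simp add: coord_sum coord_scaleR coord_E[OF assms] if_distrib cong: if_cong)
qed

text \<open>Obtained by differentiating \<open>\<langle>B, \<partial>\<^sub>m Y\<rangle> = 0\<close>, where
  \<open>B = \<partial>\<^sub>j \<partial>\<^sub>k Y - \<Gamma>\<^sup>l\<^sub>j\<^sub>k \<partial>\<^sub>l Y\<close> is the normal part of \<open>\<partial>\<^sub>j \<partial>\<^sub>k Y\<close>. Working with \<open>B\<close> in place of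
  \<open>A\<^sub>j\<^sub>k N\<close> avoids derivatives of the normal field.\<close>

lemma christoffel_derivative_lower:
  assumes y: "y \<in> V"
  shows "(\<Sum>l\<in>UNIV. partial i (\<Gamma> l j k) y * (E l y \<bullet> E m y))
      + (\<Sum>l\<in>UNIV. \<Gamma> l j k y * (partial i (E l) y \<bullet> E m y))
    = partial i (partial j (E k)) y \<bullet> E m y + A j k y * A i m y"
proof -
  let ?S = "\<lambda>z. \<Sum>l\<in>UNIV. \<Gamma> l j k z *\<^sub>R E l z"
  \<comment> \<open>the normal part of the second derivative\<close>
  let ?B = "\<lambda>z. partial j (E k) z - ?S z"
  have S: "?S differentiable (at y)"
    by (intro differentiable_sum_fun differentiable_scaleR_fun differentiable_christoffel
        differentiable_E y)
  have B: "?B differentiable (at y)"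
    by (intro differentiable_diff S differentiable_dE y)
  have "partial i ?S y = (\<Sum>l\<in>UNIV. \<Gamma> l j k y *\<^sub>R partial i (E l) y + partial i (\<Gamma> l j k) y *\<^sub>R E l y)"
    by (subst partial_sum) (intro differentiable_scaleR_fun differentiable_christoffel differentiable_E y
        partial_scaleR_fun sum.cong refl)+
  moreover have "partial i ?B y = partial i (partial j (E k)) y - partial i ?S y"
    by (rule partial_diff[OF differentiable_dE[OF y] S])
  moreover have "?B z \<bullet> E m z = 0" if "z \<in> V" for z
    using christoffel_lower[OF that] by (simp add: inner_diff_left inner_sum_left)
  then have "partial i (\<lambda>z. ?B z \<bullet> E m z) y = partial i (\<lambda>z. 0) y"
    by (intro partial_cong_open[OF open_V y])
  then have "?B y \<bullet> partial i (E m) y + partial i ?B y \<bullet> E m y = 0"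
    by (simp only: partial_inner[OF B differentiable_E[OF y]] partial_const)
  moreover have "?B y = A j k y *\<^sub>R N y"
    using gauss_formula[OF y] by simp
  ultimately show ?thesis
    by (simp add: inner_diff_left inner_add_left inner_sum_left sum.distrib second_ff_def[of _ _ i m] inner_commute[of "N y"])
qed

text \<open>Antisymmetrizing the preceding identity in \<open>i\<close> and \<open>j\<close> removes the third derivatives of \<open>Y\<close>;
  what remains on the left is the curvature tensor with its first index lowered.\<close>

lemma gauss_equation:
  assumes y: "y \<in> V"
  shows "riemann Y l i j k y = (\<Sum>m\<in>UNIV. G l m y * (A j k y * A i m y - A i k y * A j m y))"
proof -
  have swap: "(\<Sum>l\<in>UNIV. \<Gamma> l b k y * (partial a (E l) y \<bullet> E m y))
    = (\<Sum>l\<in>UNIV. (\<Sum>p\<in>UNIV. \<Gamma> l a p y * \<Gamma> p b k y) * (E l y \<bullet> E m y))" for a b m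
    unfolding christoffel_lower[OF y, symmetric] sum_distrib_left sum_distrib_right
    by (subst sum.swap) (simp add: mult_ac)
  have third: "partial i (partial j (E k)) y = partial j (partial i (E k)) y"
    by (rule partial_commute[OF open_V y smooth_on_partial[OF smooth]])
  have "(\<Sum>l\<in>UNIV. riemann Y l i j k y * (E l y \<bullet> E m y)) = A j k y * A i m y - A i k y * A j m y" for m
    using christoffel_derivative_lower[OF y, of i j k m] christoffel_derivative_lower[OF y, of j i k m]
    by (simp add: riemann_def swap third sum_subtractf sum.distrib algebra_simps)
  then show ?thesis
    using raise_index[OF y, of l "\<lambda>l. riemann Y l i j k y"] by simp
qed

lemma scalar_curvature_eq:
  assumes y: "y \<in> V"
  shows "scalar_curvature Y y = (mean_curvature Y N y)\<^sup>2 - second_ff_norm_sq Y N y"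
proof -
  let ?f = "\<lambda>i k m j. G i m y * G k j y * A i k y * A m j y"
  have "second_ff_norm_sq Y N y = (\<Sum>i\<in>UNIV. \<Sum>k\<in>UNIV. \<Sum>m\<in>UNIV. \<Sum>j\<in>UNIV. ?f i k m j)"
    by (simp add: second_ff_norm_sq_def)
  also have "\<dots> = (\<Sum>j\<in>UNIV. \<Sum>k\<in>UNIV. \<Sum>i\<in>UNIV. \<Sum>m\<in>UNIV. ?f i k m j)"
    by (rule sum_rotate4[symmetric])
  finally have 2: "second_ff_norm_sq Y N y = (\<Sum>j\<in>UNIV. \<Sum>k\<in>UNIV. \<Sum>i\<in>UNIV. \<Sum>m\<in>UNIV. ?f i k m j)" .
  have 1: "(mean_curvature Y N y)\<^sup>2 = (\<Sum>j\<in>UNIV. \<Sum>k\<in>UNIV. \<Sum>i\<in>UNIV. \<Sum>m\<in>UNIV.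
      G j k y * A j k y * (G i m y * A i m y))"
    unfolding mean_curvature_def power2_eq_square minus_mult_minus sum_distrib_right
    unfolding sum_distrib_left ..
  have "scalar_curvature Y y = (\<Sum>j\<in>UNIV. \<Sum>k\<in>UNIV. \<Sum>i\<in>UNIV. \<Sum>m\<in>UNIV.
      G j k y * A j k y * (G i m y * A i m y) - ?f i k m j)"
    unfolding scalar_curvature_def ricci_def gauss_equation[OF y] sum_distrib_left
    by (intro sum.cong refl)
      (simp add: right_diff_distrib G_symmetric[OF y, of k j for k j] second_ff_commute[OF y] mult_ac)
  then show ?thesis
    by (simp add: 1 2 sum_subtractf)
qed

text \<open>If \<open>Z\<close> is the tangential part of \<open>Q\<close>, then \<open>\<langle>Z, \<partial>\<^sub>k Y\<rangle> = \<langle>Q, \<partial>\<^sub>k Y\<rangle>\<close>. Differentiating both sides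
  compares the tangential derivatives of \<open>Z\<close> and \<open>Q\<close>; their difference is the normal component of \<open>Q\<close>
  times \<open>A\<close>, whose trace is \<open>- H\<close>.\<close>

lemma surf_div_tangential_part:
  assumes y: "y \<in> V" and Q: "Q differentiable (at y)"
  shows "surf_div Y (\<lambda>z. \<chi> i. coord z (Q z) i) y
    = (\<Sum>i\<in>UNIV. \<Sum>k\<in>UNIV. G i k y * (partial i Q y \<bullet> E k y)) - mean_curvature Y N y * (Q y \<bullet> N y)"
proof -
  let ?w = "\<lambda>j z. coord z (Q z) j"
  let ?Z = "\<lambda>z. \<Sum>j\<in>UNIV. ?w j z *\<^sub>R E j z"
  have w: "?w j differentiable (at y)" for j
    by (rule differentiable_coord[OF y Q])
  have Z: "?Z differentiable (at y)"
    by (intro differentiable_sum_fun differentiable_scaleR_fun w differentiable_E y)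
  have pZ: "partial i ?Z y = (\<Sum>j\<in>UNIV. ?w j y *\<^sub>R partial i (E j) y + partial i (?w j) y *\<^sub>R E j y)" for i
    by (subst partial_sum) (intro differentiable_scaleR_fun w differentiable_E y
        partial_scaleR_fun sum.cong refl)+
  have ZE: "partial i ?Z y \<bullet> E k y = partial i Q y \<bullet> E k y + (Q y \<bullet> N y) * A i k y" for i k
  proof -
    have "partial i (\<lambda>z. ?Z z \<bullet> E k z) y = partial i (\<lambda>z. Q z \<bullet> E k z) y"
      by (rule partial_cong_open[OF open_V y]) (simp add: inner_sum_left coord_inner_E)
    then have "?Z y \<bullet> partial i (E k) y + partial i ?Z y \<bullet> E k y
        = Q y \<bullet> partial i (E k) y + partial i Q y \<bullet> E k y"
      by (simp only: partial_inner[OF Z differentiable_E[OF y]] partial_inner[OF Q differentiable_E[OF y]])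
    moreover have "Q y \<bullet> partial i (E k) y = ?Z y \<bullet> partial i (E k) y + (Q y \<bullet> N y) * A i k y"
      by (subst frame_expansion[OF y, of "Q y"])
        (simp add: inner_add_left second_ff_def inner_commute[of "N y"])
    ultimately show ?thesis by simp
  qed
  have "surf_div Y (\<lambda>z. \<chi> i. coord z (Q z) i) y = (\<Sum>i\<in>UNIV. coord y (partial i ?Z y) i)"
    unfolding surf_div_def
    by (simp add: pZ coord_sum coord_add coord_scaleR coord_E[OF y] christoffel_eq_coord[OF y]
        sum.distrib if_distrib mult.commute cong: if_cong)
  also have "\<dots> = (\<Sum>i\<in>UNIV. \<Sum>k\<in>UNIV. G i k y * (partial i Q y \<bullet> E k y)) - mean_curvature Y N y * (Q y \<bullet> N y)"
    unfolding coord_def[of y "partial i ?Z y" i for i] ZE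
    by (simp add: mean_curvature_def distrib_left sum.distrib sum_distrib_left sum_distrib_right mult_ac)
  finally show ?thesis .
qed

end

section \<open>The weight and the stability operator in the half-space\<close>

lemma inner_radial: "(a, 0) \<bullet> v = a * fst v"
  by (simp add: inner_prod_def)

text \<open>The gradient of \<open>- log \<sigma> = |x|\<^sup>2 / 4 - log r + const\<close> in the half-space. The shrinker equation of the
  cross-section says that its normal component is the mean curvature.\<close>

definition log_weight_gradient :: "real \<times> 'c::real_normed_vector \<Rightarrow> real \<times> 'c" where
  "log_weight_gradient x = (1/2) *\<^sub>R x - inverse (fst x) *\<^sub>R (1, 0)"

lemma partial_inverse_sigma_weight:
  fixes Y :: "real^'k::finite \<Rightarrow> real \<times> (real^'m::finite)"
  assumes Y: "Y differentiable (at y)" and r: "fst (Y y) \<noteq> 0"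
  shows "partial i (\<lambda>z. inverse (sigma_weight n (Y z))) y
    = inverse (sigma_weight n (Y y)) * (log_weight_gradient (Y y) \<bullet> partial i Y y)"
proof -
  let ?K = "(4 * pi) powr (real n / 2) / (2 * pi)"
  let ?D = "frechet_derivative Y (at y)"
  have D: "(Y has_derivative ?D) (at y)" by (rule has_derivative_frechet[OF Y])
  have inv: "((\<lambda>z. inverse (fst (Y z))) has_derivative
      (\<lambda>h. - (inverse (fst (Y y)) * fst (?D h) * inverse (fst (Y y))))) (at y)"
    by (rule Deriv.has_derivative_inverse[OF r bounded_linear.has_derivative[OF bounded_linear_fst D]])
  have "((\<lambda>z. (Y z \<bullet> Y z) / 4) has_derivative (\<lambda>h. (Y y \<bullet> ?D h + ?D h \<bullet> Y y) / 4)) (at y)"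
    by (rule bounded_linear.has_derivative[OF bounded_linear_divide has_derivative_inner[OF D D]])
  from has_derivative_mult_right[OF has_derivative_mult[OF inv has_derivative_exp[OF this]], of ?K]
  have "((\<lambda>z. ?K * (inverse (fst (Y z)) * exp ((Y z \<bullet> Y z) / 4))) has_derivative
     (\<lambda>h. ?K * (inverse (fst (Y y)) * ((Y y \<bullet> ?D h + ?D h \<bullet> Y y) / 4 * exp ((Y y \<bullet> Y y) / 4))
      + - (inverse (fst (Y y)) * fst (?D h) * inverse (fst (Y y))) * exp ((Y y \<bullet> Y y) / 4)))) (at y)"
    by (simp only: mult.assoc mult.commute[of "exp _"])
  moreover have "(\<lambda>z. inverse (sigma_weight n (Y z))) = (\<lambda>z. ?K * (inverse (fst (Y z)) * exp ((Y z \<bullet> Y z) / 4)))"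
    by (simp only: inverse_sigma_weight power2_norm_eq_inner divide_inverse[of ?K] mult.assoc)
  ultimately have "partial i (\<lambda>z. inverse (sigma_weight n (Y z))) y
    = ?K * (inverse (fst (Y y)) * ((Y y \<bullet> partial i Y y + partial i Y y \<bullet> Y y) / 4 * exp ((Y y \<bullet> Y y) / 4))
      + - (inverse (fst (Y y)) * fst (partial i Y y) * inverse (fst (Y y))) * exp ((Y y \<bullet> Y y) / 4))"
    by (simp only: partial_eqI partial_def[of i Y])
  also have "\<dots> = inverse (sigma_weight n (Y y)) * (log_weight_gradient (Y y) \<bullet> partial i Y y)"
  proof -
    have "log_weight_gradient (Y y) \<bullet> partial i Y y
        = (Y y \<bullet> partial i Y y) / 2 - inverse (fst (Y y)) * fst (partial i Y y)"
      by (simp add: log_weight_gradient_def inner_diff_left inner_radial)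
    moreover have "inverse (sigma_weight n (Y y)) = ?K * (inverse (fst (Y y)) * exp ((Y y \<bullet> Y y) / 4))"
      by (simp only: inverse_sigma_weight power2_norm_eq_inner divide_inverse[of ?K] mult.assoc)
    moreover have "K * (a * ((b + b) / 4 * e) + - (a * f * a) * e) = K * (a * e) * (b / 2 - a * f)"
      for K a e b f :: real by (simp add: field_simps)
    ultimately show ?thesis by (simp only: inner_commute[of "partial i Y y"])
  qed
  finally show ?thesis .
qed

lemma partial_log_weight_gradient:
  fixes Y :: "real^'k::finite \<Rightarrow> real \<times> (real^'m::finite)"
  assumes Y: "Y differentiable (at y)" and r: "fst (Y y) \<noteq> 0"
  shows "partial i (\<lambda>z. log_weight_gradient (Y z)) y
    = (1/2) *\<^sub>R partial i Y y + (fst (partial i Y y) / (fst (Y y))\<^sup>2) *\<^sub>R (1, 0)"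
    and "(\<lambda>z. log_weight_gradient (Y z)) differentiable (at y)"
proof -
  let ?D = "frechet_derivative Y (at y)"
  have D: "(Y has_derivative ?D) (at y)" by (rule has_derivative_frechet[OF Y])
  have *: "((\<lambda>z. log_weight_gradient (Y z)) has_derivative
     (\<lambda>h. (1/2) *\<^sub>R ?D h - (- (inverse (fst (Y y)) * fst (?D h) * inverse (fst (Y y)))) *\<^sub>R (1, 0))) (at y)"
    unfolding log_weight_gradient_def
    by (intro has_derivative_diff has_derivative_scaleR_right has_derivative_scaleR_left D
        Deriv.has_derivative_inverse[OF r bounded_linear.has_derivative[OF bounded_linear_fst D]])
  show "partial i (\<lambda>z. log_weight_gradient (Y z)) y
    = (1/2) *\<^sub>R partial i Y y + (fst (partial i Y y) / (fst (Y y))\<^sup>2) *\<^sub>R (1, 0)"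
    using partial_eqI[OF *, of i]
    by (simp only: partial_def[symmetric] scaleR_minus_left diff_minus_eq_add power2_eq_square
        divide_inverse inverse_mult_distrib mult_ac)
  show "(\<lambda>z. log_weight_gradient (Y z)) differentiable (at y)"
    using * by (rule differentiableI)
qed

lemma surf_div_cong_open:
  assumes "open V" "y \<in> V" and eq: "\<And>z. z \<in> V \<Longrightarrow> W z = W' z"
  shows "surf_div Y W y = surf_div Y W' y"
  unfolding surf_div_def
  by (intro sum.cong refl arg_cong2[where f = "(+)"] partial_cong_open[OF assms(1,2)])
    (simp_all add: eq assms(2))

lemma stability_op_cong_open:
  assumes "open V" "y \<in> V" and eq: "\<And>z. z \<in> V \<Longrightarrow> f z = g z"
  shows "stability_op n k Y N f y = stability_op n k Y N g y"
proof -
  have "surf_grad Y f z = surf_grad Y g z" if "z \<in> V" for z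
    using partial_cong_open[OF assms(1) that eq] by (simp add: surf_grad_def)
  then have "drift_laplacian n Y f y = drift_laplacian n Y g y"
    unfolding drift_laplacian_def
    by (intro arg_cong2[where f = "(*)"] refl surf_div_cong_open[OF assms(1,2)]) simp
  then show ?thesis by (simp add: stability_op_def eq assms(2))
qed

locale half_space_patch = immersed_patch V Y N
  for V :: "(real^'m::finite) set" and Y N :: "real^'m \<Rightarrow> real \<times> (real^'m)" +
  assumes off_axis: "y \<in> V \<Longrightarrow> fst (Y y) > 0"
begin

text \<open>The weight cancels: \<open>\<sigma> grad (1 / \<sigma>)\<close> is the tangential part of the gradient of \<open>- log \<sigma>\<close>, so its
  divergence is given by \<open>surf_div_tangential_part\<close>. The trace of \<open>id / 2\<close> contributes \<open>m / 2\<close>, and that of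
  \<open>e\<^sub>r e\<^sub>r\<close> is the squared length of the tangential part of \<open>e\<^sub>r\<close>.\<close>

lemma drift_laplacian_inverse_sigma_weight:
  assumes y: "y \<in> V"
  shows "drift_laplacian n Y (\<lambda>z. inverse (sigma_weight n (Y z))) y
    = inverse (sigma_weight n (Y y)) * (real CARD('m) / 2
        + (1 - ((1, 0) \<bullet> N y)\<^sup>2) / (fst (Y y))\<^sup>2
        - mean_curvature Y N y * (log_weight_gradient (Y y) \<bullet> N y))"
proof -
  let ?Q = "\<lambda>z. log_weight_gradient (Y z)" and ?e = "(1, 0) :: real \<times> (real^'m)"
  have r: "fst (Y z) \<noteq> 0" if "z \<in> V" for z using off_axis[OF that] by simp
  have sig: "sigma_weight n (Y z) \<noteq> 0" if "z \<in> V" for z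
    using r[OF that] by (simp add: sigma_weight_def)
  have grad: "sigma_weight n (Y z) *\<^sub>R surf_grad Y (\<lambda>z. inverse (sigma_weight n (Y z))) z
      = (\<chi> i. coord z (?Q z) i)" if "z \<in> V" for z
  proof -
    have cancel: "sigma_weight n (Y z) * (g * (inverse (sigma_weight n (Y z)) * q)) = g * q" for g q
      using sig[OF that] by simp
    show ?thesis
      by (simp add: surf_grad_def coord_def vec_eq_iff sum_distrib_left cancel
          partial_inverse_sigma_weight[OF differentiable_Y[OF that] r[OF that]])
  qed
  have "surf_div Y (\<lambda>z. sigma_weight n (Y z) *\<^sub>R surf_grad Y (\<lambda>z. inverse (sigma_weight n (Y z))) z) y
    = surf_div Y (\<lambda>z. \<chi> i. coord z (?Q z) i) y"
    by (rule surf_div_cong_open[OF open_V y grad])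
  also have "\<dots> = (\<Sum>i\<in>UNIV. \<Sum>k\<in>UNIV. G i k y * (partial i ?Q y \<bullet> E k y))
      - mean_curvature Y N y * (?Q y \<bullet> N y)"
    by (rule surf_div_tangential_part[OF y partial_log_weight_gradient(2)[OF differentiable_Y[OF y] r[OF y]]])
  also have "(\<Sum>i\<in>UNIV. \<Sum>k\<in>UNIV. G i k y * (partial i ?Q y \<bullet> E k y))
    = (\<Sum>i\<in>UNIV. \<Sum>k\<in>UNIV. G i k y * (E i y \<bullet> E k y)) / 2
      + (\<Sum>i\<in>UNIV. coord y ?e i * (?e \<bullet> E i y)) / (fst (Y y))\<^sup>2"
    by (simp add: partial_log_weight_gradient(1)[OF differentiable_Y[OF y] r[OF y]] coord_def
        inner_add_left inner_radial sum.distrib distrib_left sum_distrib_left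
        sum_distrib_right sum_divide_distrib mult_ac)
  also have "(\<Sum>i\<in>UNIV. coord y ?e i * (?e \<bullet> E i y)) = 1 - (?e \<bullet> N y)\<^sup>2"
    using frame_inner[OF y, of ?e ?e] by (simp add: power2_eq_square)
  finally show ?thesis
    by (simp add: drift_laplacian_def metric_trace[OF y])
qed

text \<open>For \<open>k = 1\<close> the potential \<open>(|e\<^sub>r\<^sup>\<bottom>|\<^sup>2 - k\<^sup>2) / r\<^sup>2\<close> cancels the contribution of \<open>e\<^sub>r e\<^sub>r / r\<^sup>2\<close> to the
  drift Laplacian, and the Gauss equation turns \<open>|A|\<^sup>2 - H\<^sup>2\<close> into the scalar curvature.\<close>

lemma stability_op_inverse_sigma_weight:
  assumes y: "y \<in> V"
    and shrinker: "mean_curvature Y N y = log_weight_gradient (Y y) \<bullet> N y"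
  shows "stability_op n 1 Y N (\<lambda>z. inverse (sigma_weight n (Y z))) y
    = ((real CARD('m) + 1) / 2 - scalar_curvature Y y) * inverse (sigma_weight n (Y y))"
proof -
  have "stability_op n 1 Y N (\<lambda>z. inverse (sigma_weight n (Y z))) y
    = inverse (sigma_weight n (Y y)) * (real CARD('m) / 2 + 1 / 2
        + (1 - ((1, 0) \<bullet> N y)\<^sup>2) / (fst (Y y))\<^sup>2 + ((1, 0) \<bullet> N y)\<^sup>2 / (fst (Y y))\<^sup>2 - 1 / (fst (Y y))\<^sup>2
        - ((mean_curvature Y N y)\<^sup>2 - second_ff_norm_sq Y N y))"
    by (simp add: stability_op_def drift_laplacian_inverse_sigma_weight[OF y] shrinker[symmetric]
        power2_eq_square algebra_simps)
  also have "\<dots> = inverse (sigma_weight n (Y y)) * (real CARD('m) / 2 + 1 / 2 - scalar_curvature Y y)"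
    by (simp add: scalar_curvature_eq[OF y] diff_divide_distrib)
  finally show ?thesis by (simp add: field_simps)
qed

end

section \<open>Maps lifted through an immersion\<close>

text \<open>Since \<open>c\<close> is continuous and \<open>h\<close> is close to the identity near \<open>c x\<close>, the increments of \<open>c\<close>
  are bounded by twice those of \<open>h \<circ> c\<close>, hence are of first order, and then the error of \<open>h\<close> on them is of
  smaller order.\<close>

lemma has_derivative_factor_through_identity:
  fixes c :: "'a::real_normed_vector \<Rightarrow> 'b::real_normed_vector" and h :: "'b \<Rightarrow> 'b"
  assumes h: "(h has_derivative (\<lambda>v. v)) (at (c x))"
    and M: "((\<lambda>z. h (c z)) has_derivative M) (at x)"
    and c: "isCont c x"
  shows "(c has_derivative M) (at x)"
  unfolding has_derivative_at_alt
proof (intro conjI allI impI)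
  show blM: "bounded_linear M" using M by (rule has_derivative_bounded_linear)
  fix e :: real assume e: "e > 0"
  obtain B where B: "B > 0" "\<And>v. norm (M v) \<le> norm v * B"
    using bounded_linear.pos_bounded[OF blM] by blast
  \<comment> \<open>\<open>e1 \<le> 1 / 2\<close> gives \<open>|c z - c x| \<le> 2 (B + 1) |z - x|\<close>, and then the second bound makes the error of
    \<open>h\<close> at most \<open>e / 2\<close> times \<open>|z - x|\<close>\<close>
  define e1 where "e1 = min (1/2) (e / (4 * (B + 1)))"
  have e1: "0 < e1" "e1 \<le> 1/2" "e1 * (2 * (B + 1)) \<le> e / 2"
  proof -
    show "0 < e1" using e B(1) by (simp add: e1_def)
    show "e1 \<le> 1/2" unfolding e1_def by (rule min.cobounded1)
    have "e1 * (2 * (B + 1)) \<le> e / (4 * (B + 1)) * (2 * (B + 1))"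
      using B(1) by (intro mult_right_mono) (auto simp: e1_def)
    also have "\<dots> = e / 2" using B(1) by (simp add: field_simps)
    finally show "e1 * (2 * (B + 1)) \<le> e / 2" .
  qed
  define e2 where "e2 = min 1 (e / 2)"
  have e2: "0 < e2" "e2 \<le> 1" "e2 \<le> e / 2" using e by (auto simp: e2_def)
  obtain d1 where d1: "d1 > 0"
    "\<And>w. norm (w - c x) < d1 \<Longrightarrow> norm (h w - h (c x) - (w - c x)) \<le> e1 * norm (w - c x)"
    using h e1(1) unfolding has_derivative_at_alt by blast
  obtain d2 where d2: "d2 > 0"
    "\<And>z. norm (z - x) < d2 \<Longrightarrow> norm (h (c z) - h (c x) - M (z - x)) \<le> e2 * norm (z - x)"
    using M e2(1) unfolding has_derivative_at_alt by blast
  obtain d3 where d3: "d3 > 0" "\<And>z. norm (z - x) < d3 \<Longrightarrow> norm (c z - c x) < d1"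
    using c d1(1) unfolding continuous_at_eps_delta by (auto simp: dist_norm)
  show "\<exists>d>0. \<forall>z. norm (z - x) < d \<longrightarrow> norm (c z - c x - M (z - x)) \<le> e * norm (z - x)"
  proof (intro exI conjI allI impI)
    show "min d2 d3 > 0" using d2 d3 by simp
    fix z assume "norm (z - x) < min d2 d3"
    then have 1: "norm (h (c z) - h (c x) - (c z - c x)) \<le> e1 * norm (c z - c x)"
      and 2: "norm (h (c z) - h (c x) - M (z - x)) \<le> e2 * norm (z - x)"
      using d1(2) d2(2) d3(2) by auto
    have 3: "norm (c z - c x - M (z - x)) \<le> e1 * norm (c z - c x) + e2 * norm (z - x)"
    proof -
      have "c z - c x - M (z - x) = (h (c z) - h (c x) - M (z - x)) - (h (c z) - h (c x) - (c z - c x))"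
        by simp
      then have "norm (c z - c x - M (z - x)) \<le> norm (h (c z) - h (c x) - M (z - x))
          + norm (h (c z) - h (c x) - (c z - c x))"
        by (metis norm_triangle_ineq4)
      then show ?thesis using 1 2 by linarith
    qed
    have "norm (c z - c x) \<le> norm (c z - c x - M (z - x)) + norm (M (z - x))"
      using norm_triangle_ineq[of "c z - c x - M (z - x)" "M (z - x)"] by simp
    also have "\<dots> \<le> (e1 * norm (c z - c x) + e2 * norm (z - x)) + norm (z - x) * B"
      using 3 B(2)[of "z - x"] by linarith
    also have "\<dots> \<le> (1/2 * norm (c z - c x) + 1 * norm (z - x)) + norm (z - x) * B"
      using e1(2) e2(2) by (intro add_mono mult_right_mono order_refl) auto
    finally have "norm (c z - c x) \<le> 2 * (B + 1) * norm (z - x)"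
      by (simp add: algebra_simps)
    then have "e1 * norm (c z - c x) \<le> e1 * (2 * (B + 1) * norm (z - x))"
      using e1(1) by (intro mult_left_mono) auto
    also have "\<dots> = e1 * (2 * (B + 1)) * norm (z - x)" by simp
    also have "\<dots> \<le> e / 2 * norm (z - x)" using e1(3) by (intro mult_right_mono) auto
    finally have "e1 * norm (c z - c x) \<le> e / 2 * norm (z - x)" .
    moreover have "e2 * norm (z - x) \<le> e / 2 * norm (z - x)"
      using e2(3) by (intro mult_right_mono) auto
    ultimately show "norm (c z - c x - M (z - x)) \<le> e * norm (z - x)"
      using 3 by (simp add: field_simps)
  qed
qed

text \<open>A linear left inverse of the derivative of \<open>f\<close> reduces this to the case of derivative one.\<close>

lemma differentiable_lift_through_immersion:
  fixes c :: "'a::real_normed_vector \<Rightarrow> 'b::euclidean_space" and f :: "'b \<Rightarrow> 'd::euclidean_space"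
  assumes f: "f differentiable (at (c x))" "inj (frechet_derivative f (at (c x)))"
    and fc: "(\<lambda>z. f (c z)) differentiable (at x)"
    and c: "isCont c x"
  shows "c differentiable (at x)"
proof -
  let ?D = "frechet_derivative f (at (c x))"
  obtain L where L: "linear L" "L \<circ> ?D = id"
    using linear_injective_left_inverse[OF linear_frechet_derivative[OF f(1)] f(2)] by blast
  have bl: "bounded_linear L" using L(1) by (simp add: linear_conv_bounded_linear)
  have "((\<lambda>w. L (f w)) has_derivative (\<lambda>v. L (?D v))) (at (c x))"
    by (rule bounded_linear.has_derivative[OF bl has_derivative_frechet[OF f(1)]])
  then have "((\<lambda>w. L (f w)) has_derivative (\<lambda>v. v)) (at (c x))"
    using L(2) by (simp add: fun_eq_iff)
  then show ?thesis
    using has_derivative_factor_through_identity[OF _ bounded_linear.has_derivative[OF bl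
      has_derivative_frechet[OF fc]] c] by (blast intro: differentiableI)
qed

section \<open>The second fundamental form along submanifolds and linear fields\<close>

lemma sum_swap_pairs:
  "(\<Sum>a\<in>I. \<Sum>b\<in>J. \<Sum>k\<in>K. \<Sum>l\<in>L. f a b k l) = (\<Sum>k\<in>K. \<Sum>l\<in>L. \<Sum>a\<in>I. \<Sum>b\<in>J. f a b k l)"
proof -
  have "(\<Sum>a\<in>I. \<Sum>b\<in>J. \<Sum>k\<in>K. \<Sum>l\<in>L. f a b k l) = (\<Sum>a\<in>I. \<Sum>k\<in>K. \<Sum>l\<in>L. \<Sum>b\<in>J. f a b k l)"
    by (intro sum.cong refl, subst sum.swap) (intro sum.cong refl sum.swap)
  also have "\<dots> = (\<Sum>k\<in>K. \<Sum>l\<in>L. \<Sum>a\<in>I. \<Sum>b\<in>J. f a b k l)"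
    by (subst sum.swap) (intro sum.cong refl sum.swap)
  finally show ?thesis .
qed

context immersed_patch
begin

text \<open>The second fundamental form as a bilinear form on ambient vectors, through their tangential parts.
  This makes it independent of the coordinates, as needed for comparing two hypersurfaces.\<close>

definition II :: "real^'n \<Rightarrow> 'b \<Rightarrow> 'b \<Rightarrow> real" where
  "II y v w = (\<Sum>a\<in>UNIV. \<Sum>b\<in>UNIV. coord y v a * coord y w b * A a b y)"

lemma coord_partial_compose:
  fixes c :: "real^'k::finite \<Rightarrow> real^'n"
  assumes W: "open W" "x \<in> W" and cV: "c x \<in> V" and c: "c differentiable (at x)"
    and Z: "\<And>z. z \<in> W \<Longrightarrow> Z z = Y (c z)"
  shows "partial j Z x = (\<Sum>b\<in>UNIV. partial j c x $ b *\<^sub>R E b (c x))"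
    and "coord (c x) (partial j Z x) a = partial j c x $ a"
proof -
  show *: "partial j Z x = (\<Sum>b\<in>UNIV. partial j c x $ b *\<^sub>R E b (c x))"
    using partial_cong_open[OF W Z] partial_compose[OF c differentiable_Y[OF cV]] by simp
  show "coord (c x) (partial j Z x) a = partial j c x $ a"
    by (simp add: * coord_sum coord_scaleR coord_E[OF cV] if_distrib cong: if_cong)
qed

text \<open>The coefficients of \<open>\<partial>\<^sub>j Z\<close> in the frame along \<open>c\<close> are the derivatives of \<open>c\<close>. They are differentiable
  in turn because the inverse metric recovers them from \<open>\<partial>\<^sub>j Z\<close>, and differentiating them only
  contributes tangential terms.\<close>

lemma second_ff_compose:
  fixes c :: "real^'k::finite \<Rightarrow> real^'n"
  assumes W: "open W" "x \<in> W" and cV: "\<And>z. z \<in> W \<Longrightarrow> c z \<in> V"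
    and c: "\<And>z. z \<in> W \<Longrightarrow> c differentiable (at z)"
    and Z: "\<And>z. z \<in> W \<Longrightarrow> Z z = Y (c z)"
    and dZ: "partial j Z differentiable (at x)"
  shows "partial i (partial j Z) x \<bullet> N (c x) = II (c x) (partial i Z x) (partial j Z x)"
proof -
  let ?w = "\<lambda>b z. coord (c z) (partial j Z z) b"
  have comp: "(\<lambda>z. f (c z)) differentiable (at x)"
    if "f differentiable (at (c x))" for f :: "real^'n \<Rightarrow> 'x::real_normed_vector"
    using differentiable_chain_at[OF c[OF W(2)] that] by (simp add: o_def)
  have w: "?w b differentiable (at x)" for b
    unfolding coord_def
    by (intro differentiable_sum_fun differentiable_mult comp differentiable_G differentiable_inner_fun
      differentiable_E cV W dZ)
  have Ec: "(\<lambda>z. E b (c z)) differentiable (at x)" for b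
    by (intro comp differentiable_E cV W)
  have "partial j Z z = (\<Sum>b\<in>UNIV. ?w b z *\<^sub>R E b (c z))" if "z \<in> W" for z
    using coord_partial_compose[OF W(1) that cV[OF that] c[OF that] Z, of j] by simp
  then have "partial i (partial j Z) x = partial i (\<lambda>z. \<Sum>b\<in>UNIV. ?w b z *\<^sub>R E b (c z)) x"
    by (rule partial_cong_open[OF W])
  also have "\<dots> = (\<Sum>b\<in>UNIV. ?w b x *\<^sub>R partial i (\<lambda>z. E b (c z)) x + partial i (?w b) x *\<^sub>R E b (c x))"
    by (subst partial_sum) (intro differentiable_scaleR_fun w Ec partial_scaleR_fun sum.cong refl)+
  finally have "partial i (partial j Z) x \<bullet> N (c x)
      = (\<Sum>b\<in>UNIV. ?w b x * (partial i (\<lambda>z. E b (c z)) x \<bullet> N (c x)))"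
    by (simp add: inner_sum_left inner_add_left tangent_normal[OF cV[OF W(2)]])
  also have "\<dots> = (\<Sum>b\<in>UNIV. ?w b x * (\<Sum>a\<in>UNIV. coord (c x) (partial i Z x) a * A a b (c x)))"
    by (simp add: partial_compose[OF c[OF W(2)] differentiable_E[OF cV[OF W(2)]]] inner_sum_left
        second_ff_def coord_partial_compose(2)[OF W cV[OF W(2)] c[OF W(2)] Z])
  also have "\<dots> = II (c x) (partial i Z x) (partial j Z x)"
    unfolding II_def sum_distrib_left by (subst sum.swap) (simp add: mult_ac)
  finally show ?thesis .
qed

text \<open>Applied to the rotation field. A tangent field \<open>z \<mapsto> B z\<close> has derivative \<open>B (B z)\<close> along itself, and the
  normal component of the derivative of a tangent field along itself is its second fundamental form.\<close>

lemma II_linear_tangent_field: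
  assumes B: "bounded_linear B" and tangent: "\<And>z. z \<in> V \<Longrightarrow> B (Y z) \<bullet> N z = 0" and y: "y \<in> V"
  shows "II y (B (Y y)) (B (Y y)) = B (B (Y y)) \<bullet> N y"
proof -
  let ?t = "\<lambda>b z. coord z (B (Y z)) b"
  have expand: "B (Y z) = (\<Sum>b\<in>UNIV. ?t b z *\<^sub>R E b z)" if "z \<in> V" for z
    using frame_expansion[OF that, of "B (Y z)"] tangent[OF that] by simp
  have t: "?t b differentiable (at y)" for b
    by (intro differentiable_coord y differentiable_bounded_linear[OF B] differentiable_Y)
  have "B (E a y) \<bullet> N y = (\<Sum>b\<in>UNIV. ?t b y * A a b y)" for a
  proof -
    have "B (E a y) = partial a (\<lambda>z. B (Y z)) y"
      by (rule partial_bounded_linear[OF B differentiable_Y[OF y], symmetric])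
    also have "\<dots> = partial a (\<lambda>z. \<Sum>b\<in>UNIV. ?t b z *\<^sub>R E b z) y"
      by (rule partial_cong_open[OF open_V y expand])
    also have "\<dots> = (\<Sum>b\<in>UNIV. ?t b y *\<^sub>R partial a (E b) y + partial a (?t b) y *\<^sub>R E b y)"
      by (subst partial_sum) (intro differentiable_scaleR_fun t differentiable_E y
          partial_scaleR_fun sum.cong refl)+
    finally show ?thesis
      by (simp add: inner_sum_left inner_add_left tangent_normal[OF y] second_ff_def)
  qed
  moreover have "B (B (Y y)) = (\<Sum>a\<in>UNIV. ?t a y *\<^sub>R B (E a y))"
    using bounded_linear.linear[OF B]
    by (subst expand[OF y]) (simp add: linear_sum linear_cmul)
  ultimately show ?thesis
    by (simp add: II_def inner_sum_left sum_distrib_left mult_ac)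
qed

text \<open>The trace of the second fundamental form can be computed from any family of vectors satisfying
  Parseval's identity together with the normal. Evaluating that identity on the dual frame expresses the
  inverse metric by the family.\<close>

lemma mean_curvature_eq_II_sum:
  fixes p :: "'k::finite \<Rightarrow> 'b"
  assumes y: "y \<in> V"
    and parseval: "\<And>v w. v \<bullet> w = (\<Sum>k\<in>UNIV. \<Sum>l\<in>UNIV. g k l * (v \<bullet> p k) * (w \<bullet> p l))
      + (v \<bullet> N y) * (w \<bullet> N y) + s * (v \<bullet> t) * (w \<bullet> t)"
  shows "mean_curvature Y N y = - (\<Sum>k\<in>UNIV. \<Sum>l\<in>UNIV. g k l * II y (p k) (p l)) - s * II y t t"
proof -
  \<comment> \<open>the dual frame, whose inner products are the entries of the inverse metric\<close>
  let ?d = "\<lambda>a. \<Sum>b\<in>UNIV. G a b y *\<^sub>R E b y"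
  have d: "?d a \<bullet> v = coord y v a" for a v
    by (subst inner_commute) (simp add: coord_def inner_sum_right)
  have dN: "coord y (N y) a = 0" for a
    by (simp add: coord_def inner_commute[of "N y"] tangent_normal[OF y])
  have "G a b y = (\<Sum>k\<in>UNIV. \<Sum>l\<in>UNIV. g k l * coord y (p k) a * coord y (p l) b)
      + s * coord y t a * coord y t b" for a b
  proof -
    have "G a b y = ?d b \<bullet> ?d a"
      using d[of b "?d a"] by (simp add: coord_sum coord_scaleR coord_E[OF y] if_distrib cong: if_cong)
    also have "\<dots> = ?d a \<bullet> ?d b" by (rule inner_commute)
    also have "\<dots> = (\<Sum>k\<in>UNIV. \<Sum>l\<in>UNIV. g k l * coord y (p k) a * coord y (p l) b)
      + s * coord y t a * coord y t b"
      using parseval[of "?d a" "?d b"] by (simp only: d dN mult_zero_left add_0_right)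
    finally show ?thesis .
  qed
  then have "(\<Sum>a\<in>UNIV. \<Sum>b\<in>UNIV. G a b y * A a b y)
    = (\<Sum>a\<in>UNIV. \<Sum>b\<in>UNIV. \<Sum>k\<in>UNIV. \<Sum>l\<in>UNIV. g k l * (coord y (p k) a * coord y (p l) b * A a b y))
      + s * II y t t"
    by (simp add: II_def distrib_left distrib_right sum.distrib sum_distrib_left sum_distrib_right mult_ac)
  also have "(\<Sum>a\<in>UNIV. \<Sum>b\<in>UNIV. \<Sum>k\<in>UNIV. \<Sum>l\<in>UNIV. g k l * (coord y (p k) a * coord y (p l) b * A a b y))
    = (\<Sum>k\<in>UNIV. \<Sum>l\<in>UNIV. g k l * II y (p k) (p l))"
    unfolding II_def sum_distrib_left by (rule sum_swap_pairs)
  finally show ?thesis by (simp add: mean_curvature_def)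
qed

end

section \<open>Rotationally symmetric hypersurfaces\<close>

definition half_space_embed :: "real \<times> (real^'m::finite) \<Rightarrow> complex \<times> (real^'m)" where
  "half_space_embed x = (complex_of_real (fst x), snd x)"

definition half_space_proj :: "complex \<times> (real^'m::finite) \<Rightarrow> real \<times> (real^'m)" where
  "half_space_proj v = (Re (fst v), snd v)"

definition rotation_field :: "complex \<times> (real^'m::finite) \<Rightarrow> complex \<times> (real^'m)" where
  "rotation_field v = (\<i> * fst v, 0)"

lemma bounded_linear_half_space_embed: "bounded_linear half_space_embed"
  unfolding half_space_embed_def
  by (intro bounded_linear_Pair bounded_linear_compose[OF bounded_linear_of_real]
      bounded_linear_fst bounded_linear_snd)

lemma bounded_linear_rotation_field: "bounded_linear rotation_field"
  unfolding rotation_field_def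
  by (intro bounded_linear_Pair bounded_linear_compose[OF bounded_linear_mult_right]
      bounded_linear_fst bounded_linear_zero)

lemma inner_half_space_embed: "v \<bullet> half_space_embed x = half_space_proj v \<bullet> x"
  by (simp add: half_space_embed_def half_space_proj_def inner_prod_def inner_complex_def)

lemma inner_eq_half_space_proj:
  "v \<bullet> w = half_space_proj v \<bullet> half_space_proj w + Im (fst v) * Im (fst w)"
  by (simp add: half_space_proj_def inner_prod_def inner_complex_def)

lemma inner_rotation_field_embed: "v \<bullet> rotation_field (half_space_embed x) = fst x * Im (fst v)"
  by (simp add: rotation_field_def half_space_embed_def inner_prod_def inner_complex_def)

text \<open>Along the slice, the coordinate fields of the cross-section, the rotation field \<open>T\<close> of length \<open>r\<close> and the
  normal satisfy Parseval's identity in the ambient space, so the mean curvature of the large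
  hypersurface is the sum of that of the cross-section and of \<open>- A(T, T) / r\<^sup>2\<close>, up to the choice of normals.\<close>

lemma mean_curvature_cross_section:
  fixes X N :: "real^'n::finite \<Rightarrow> complex \<times> (real^'m::finite)"
    and Y M :: "real^'m \<Rightarrow> real \<times> (real^'m)" and c :: "real^'m \<Rightarrow> real^'n"
  assumes "immersed_patch U X N" and "half_space_patch W Y M"
    and x: "x \<in> W" and cU: "\<And>z. z \<in> W \<Longrightarrow> c z \<in> U" and c: "\<And>z. z \<in> W \<Longrightarrow> isCont c z"
    and slice: "\<And>z. z \<in> W \<Longrightarrow> half_space_embed (Y z) = X (c z)"
    and tangent: "\<And>z. z \<in> U \<Longrightarrow> rotation_field (X z) \<bullet> N z = 0"
    and shrinker: "mean_curvature X N (c x) = 1/2 * (X (c x) \<bullet> N (c x))"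
  shows "mean_curvature Y M x = log_weight_gradient (Y x) \<bullet> M x"
proof -
  interpret S: immersed_patch U X N by fact
  interpret G: half_space_patch W Y M by fact
  let ?Z = "\<lambda>z. half_space_embed (Y z)" and ?N = "N (c x)" and ?r = "fst (Y x)"
  let ?t = "rotation_field (half_space_embed (Y x))"
  have r: "?r > 0" by (rule G.off_axis[OF x])
  have dc: "c differentiable (at z)" if "z \<in> W" for z
  proof (rule differentiable_lift_through_immersion[OF _ _ _ c[OF that]])
    show "X differentiable (at (c z))" by (rule S.differentiable_Y[OF cU[OF that]])
    show "inj (frechet_derivative X (at (c z)))"
      using S.immersion cU[OF that] by (simp add: smooth_immersion_on_def)
    have "?Z differentiable (at z)"
      by (rule differentiable_bounded_linear[OF bounded_linear_half_space_embed G.differentiable_Y[OF that]])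
    then show "(\<lambda>z. X (c z)) differentiable (at z)"
      using differentiable_cong_open[OF G.open_V that, of "\<lambda>z. X (c z)" ?Z] slice by simp
  qed
  have pZ: "partial k ?Z z = half_space_embed (partial k Y z)" if "z \<in> W" for k z
    by (rule partial_bounded_linear[OF bounded_linear_half_space_embed G.differentiable_Y[OF that]])
  have pZ_diff: "partial l ?Z differentiable (at x)" for l
    using differentiable_cong_open[OF G.open_V x, of "partial l ?Z" "\<lambda>z. half_space_embed (partial l Y z)"]
      pZ differentiable_bounded_linear[OF bounded_linear_half_space_embed G.differentiable_E[OF x]]
    by simp
  have ppZ: "partial k (partial l ?Z) x = half_space_embed (partial k (partial l Y) x)" for k l
    using partial_cong_open[OF G.open_V x, of "partial l ?Z" "\<lambda>z. half_space_embed (partial l Y z)" k] pZ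
      partial_bounded_linear[OF bounded_linear_half_space_embed G.differentiable_E[OF x]] by simp
  have second: "S.II (c x) (half_space_embed (partial k Y x)) (half_space_embed (partial l Y x))
      = half_space_proj ?N \<bullet> partial k (partial l Y) x" for k l
    using S.second_ff_compose[where i = k and j = l, OF G.open_V x cU dc slice pZ_diff]
    unfolding ppZ pZ[OF x] by (simp add: inner_commute[of _ ?N] inner_half_space_embed)
  have rot: "S.II (c x) ?t ?t = - ?r * ((1, 0) \<bullet> half_space_proj ?N)"
    using S.II_linear_tangent_field[OF bounded_linear_rotation_field tangent cU[OF x]]
    unfolding slice[OF x, symmetric]
    by (simp add: rotation_field_def half_space_embed_def half_space_proj_def inner_prod_def inner_complex_def)
  have N0: "Im (fst ?N) = 0"
    using tangent[OF cU[OF x]] r inner_rotation_field_embed[of ?N "Y x"]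
    by (simp add: slice[OF x, symmetric] inner_commute)
  have NE: "half_space_proj ?N \<bullet> partial k Y x = 0" for k
  proof -
    have "partial k ?Z x = (\<Sum>b\<in>UNIV. partial k c x $ b *\<^sub>R partial b X (c x))"
      by (rule S.coord_partial_compose(1)[OF G.open_V x cU[OF x] dc[OF x] slice])
    then have "?N \<bullet> partial k ?Z x = 0"
      by (simp add: inner_sum_right S.tangent_normal[OF cU[OF x]] inner_commute[of ?N "partial _ X _"])
    then show ?thesis by (simp add: pZ[OF x] inner_half_space_embed)
  qed
  \<comment> \<open>the sign relating the two unit normals; the shrinker equation does not depend on it\<close>
  define s where "s = half_space_proj ?N \<bullet> M x"
  have Ns: "half_space_proj ?N = s *\<^sub>R M x"
    using G.frame_expansion[OF x, of "half_space_proj ?N"] by (simp add: G.coord_def NE s_def)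
  have "half_space_proj ?N \<bullet> half_space_proj ?N = 1"
    using S.N_inner_N[OF cU[OF x]] inner_eq_half_space_proj[of ?N ?N] N0 by simp
  then have s: "s * s = 1" by (simp add: Ns G.N_inner_N[OF x])
  have parseval: "v \<bullet> w = (\<Sum>k\<in>UNIV. \<Sum>l\<in>UNIV. inv_metric Y x $ k $ l * (v \<bullet> half_space_embed (partial k Y x))
        * (w \<bullet> half_space_embed (partial l Y x)))
      + (v \<bullet> ?N) * (w \<bullet> ?N) + (1 / ?r\<^sup>2) * (v \<bullet> ?t) * (w \<bullet> ?t)" for v w
  proof -
    have vN: "v \<bullet> ?N = s * (half_space_proj v \<bullet> M x)" for v
      using inner_eq_half_space_proj[of v ?N] by (simp add: N0 Ns)
    have "(v \<bullet> ?N) * (w \<bullet> ?N) = (s * s) * ((half_space_proj v \<bullet> M x) * (half_space_proj w \<bullet> M x))"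
      by (simp add: vN)
    moreover have "(1 / ?r\<^sup>2) * (v \<bullet> ?t) * (w \<bullet> ?t) = Im (fst v) * Im (fst w)"
      using r by (simp add: inner_rotation_field_embed power2_eq_square)
    moreover have "(\<Sum>k\<in>UNIV. G.coord x (half_space_proj w) k * (half_space_proj v \<bullet> partial k Y x))
      = (\<Sum>k\<in>UNIV. \<Sum>l\<in>UNIV. inv_metric Y x $ k $ l * (v \<bullet> half_space_embed (partial k Y x))
        * (w \<bullet> half_space_embed (partial l Y x)))"
      by (simp add: G.coord_def inner_half_space_embed sum_distrib_left sum_distrib_right mult_ac)
    ultimately show ?thesis
      using inner_eq_half_space_proj[of v w] G.frame_inner[OF x, of "half_space_proj w" "half_space_proj v"] s
      by (simp add: inner_commute mult.commute)
  qed
  have "mean_curvature X N (c x)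
    = - (\<Sum>k\<in>UNIV. \<Sum>l\<in>UNIV. inv_metric Y x $ k $ l * (s * second_ff Y M k l x))
      + s * (((1, 0) \<bullet> M x) / ?r)"
    using S.mean_curvature_eq_II_sum[OF cU[OF x] parseval] r
    by (simp add: second rot Ns second_ff_def inner_commute[of "M x"] power2_eq_square)
  also have "\<dots> = s * (mean_curvature Y M x + ((1, 0) \<bullet> M x) / ?r)"
    by (simp add: mean_curvature_def distrib_left right_diff_distrib sum_distrib_left mult_ac)
  finally have "s * (mean_curvature Y M x + ((1, 0) \<bullet> M x) / ?r) = s * (1/2 * (Y x \<bullet> M x))"
    using shrinker inner_half_space_embed[of ?N "Y x"] slice[OF x]
    by (simp add: Ns inner_commute)
  then have "s * s * (mean_curvature Y M x + ((1, 0) \<bullet> M x) / ?r) = s * s * (1/2 * (Y x \<bullet> M x))"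
    by (simp only: mult.assoc)
  then have "mean_curvature Y M x = 1/2 * (Y x \<bullet> M x) - ((1, 0) \<bullet> M x) / ?r"
    unfolding s by simp
  then show ?thesis
    unfolding log_weight_gradient_def inner_diff_left inner_scaleR_left using r by (simp add: field_simps)
qed

lemma immersed_hypersurface_patch:
  assumes "immersed_hypersurface S" "(U, \<phi>) \<in> atlas S"
  shows "immersed_patch U (position S \<circ> \<phi>) (unit_normal S \<circ> \<phi>)"
proof
  have "openin (manifold S) (\<phi> ` U)"
    using assms by (auto simp: immersed_hypersurface_def smooth_atlas_def local_parametrization_def)
  then have "\<phi> ` U \<subseteq> topspace (manifold S)" by (rule openin_subset)
  then show "norm ((unit_normal S \<circ> \<phi>) y) = 1" if "y \<in> U" for y
    using assms that by (auto simp: immersed_hypersurface_def)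
qed (use assms in \<open>auto simp: immersed_hypersurface_def smooth_atlas_def local_parametrization_def\<close>)

text \<open>Finitely many charts cover \<open>S\<close>, and each has an image of lower dimension.\<close>

lemma negligible_image_of_compact_hypersurface:
  assumes S: "immersed_hypersurface S" and "compact_space (manifold S)"
  shows "negligible (position S ` topspace (manifold S))"
proof -
  let ?P = "\<lambda>(U, \<phi>). \<phi> ` U"
  have cover: "\<Union> (?P ` atlas S) = topspace (manifold S)"
    and op: "\<And>T. T \<in> ?P ` atlas S \<Longrightarrow> openin (manifold S) T"
    using S by (auto simp: immersed_hypersurface_def smooth_atlas_def local_parametrization_def)
  then obtain \<F> where "finite \<F>" "\<F> \<subseteq> ?P ` atlas S" "topspace (manifold S) \<subseteq> \<Union>\<F>"
    using assms(2) unfolding compact_space_def compactin_def by (metis order_refl)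
  moreover have "negligible (position S ` T)" if "T \<in> ?P ` atlas S" for T
  proof -
    have "\<exists>a\<in>atlas S. T = ?P a" using that by (simp only: image_iff)
    then obtain a where a: "a \<in> atlas S" "T = ?P a" ..
    obtain U \<phi> where "a = (U, \<phi>)" by (cases a)
    with a have U: "(U, \<phi>) \<in> atlas S" "T = \<phi> ` U" by auto
    interpret immersed_patch U "position S \<circ> \<phi>" "unit_normal S \<circ> \<phi>"
      by (rule immersed_hypersurface_patch[OF S U(1)])
    have "negligible ((position S \<circ> \<phi>) ` U)"
      using codim differentiable_Y
      by (intro negligible_differentiable_image_lowdim differentiable_at_imp_differentiable_on) auto
    then show ?thesis by (simp add: U(2) image_comp)
  qed
  ultimately have "negligible (\<Union>T\<in>\<F>. position S ` T)"
    by (intro negligible_Union) auto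
  then show ?thesis
    by (rule negligible_subset) (use \<open>topspace (manifold S) \<subseteq> \<Union>\<F>\<close> in auto)
qed

text \<open>Suppose that the rotation field is transverse to the sheet at \<open>x\<close>. Then \<open>(\<theta>, z) \<mapsto> rotate \<theta> (X z)\<close> has a
  surjective derivative at \<open>(0, x)\<close>, so its image has interior points. By invariance it lies in the image of \<open>S\<close>,
  which is negligible.\<close>

lemma rotation_field_tangent:
  fixes S :: "('p, 'n::finite, complex \<times> (real^'m::finite)) hypersurface"
  assumes S: "immersed_hypersurface S" and "compact_space (manifold S)"
    and sym: "rotationally_symmetric S"
    and U: "(U, \<phi>) \<in> atlas S" and x: "x \<in> U"
  shows "rotation_field (position S (\<phi> x)) \<bullet> unit_normal S (\<phi> x) = 0"
proof (rule ccontr)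
  let ?X = "position S \<circ> \<phi>" and ?N = "unit_normal S \<circ> \<phi>"
  let ?t = "rotation_field (?X x)"
  assume "rotation_field (position S (\<phi> x)) \<bullet> unit_normal S (\<phi> x) \<noteq> 0"
  then have tN: "?t \<bullet> ?N x \<noteq> 0" by simp
  interpret immersed_patch U ?X ?N by (rule immersed_hypersurface_patch[OF S U])
  let ?D = "frechet_derivative ?X (at x)"
  let ?K = "\<lambda>q. rotate (fst q) (?X (snd q))" and ?K' = "\<lambda>q. fst q *\<^sub>R ?t + ?D (snd q)"
  let ?a = "\<lambda>v. (v \<bullet> ?N x) / (?t \<bullet> ?N x)"
  \<comment> \<open>right inverse of \<open>?K'\<close>: a multiple of the rotation field absorbs the normal component of \<open>v\<close>,
    and the remainder is tangent to the sheet\<close>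
  let ?L = "\<lambda>v. (?a v, \<chi> k. coord x (v - ?a v *\<^sub>R ?t) k)"
  have K: "?K q = (cis (fst q) * fst (?X (snd q)), snd (?X (snd q)))" for q
    by (simp add: rotate_def split_beta)
  have cont: "continuous_on (UNIV \<times> U) ?K"
  proof -
    have "continuous_on (UNIV \<times> U) (\<lambda>q::real \<times> (real^'n). ?X (snd q))"
      by (rule continuous_on_compose2[OF smooth_on_imp_continuous_on[OF smooth]]) (auto intro: continuous_intros)
    then show ?thesis unfolding K by (intro continuous_intros continuous_on_cis) auto
  qed
  have deriv: "(?K has_derivative ?K') (at (0, x))"
  proof -
    have X: "((\<lambda>q. ?X (snd q)) has_derivative (\<lambda>q. ?D (snd q))) (at (0, x))"
      using has_derivative_compose[OF bounded_linear_imp_has_derivative[OF bounded_linear_snd],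
          of ?X ?D "(0, x)" UNIV] has_derivative_frechet[OF differentiable_Y[OF x]] by simp
    have c: "((\<lambda>q. cis (fst q)) has_derivative (\<lambda>q. fst q *\<^sub>R \<i>)) (at (0 :: real, x))"
      using has_derivative_cis[OF bounded_linear_imp_has_derivative[OF bounded_linear_fst], of "(0, x)" UNIV]
      by simp
    have "(?K has_derivative (\<lambda>q. (cis (fst (0, x)) * fst (?D (snd q)) + (fst q *\<^sub>R \<i>) * fst (?X (snd (0::real, x))),
        snd (?D (snd q))))) (at (0, x))"
      unfolding K
      by (intro has_derivative_Pair has_derivative_mult c bounded_linear.has_derivative[OF bounded_linear_fst X]
          bounded_linear.has_derivative[OF bounded_linear_snd X])
    moreover have "(\<lambda>q. (cis (fst (0, x)) * fst (?D (snd q)) + (fst q *\<^sub>R \<i>) * fst (?X (snd (0::real, x))),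
        snd (?D (snd q)))) = ?K'"
      by (auto simp: rotation_field_def prod_eq_iff)
    ultimately show ?thesis by simp
  qed
  have "bounded_linear ?L"
    unfolding linear_conv_bounded_linear[symmetric]
    by (rule linearI) (auto simp: vec_eq_iff coord_def inner_diff_left inner_add_left add_divide_distrib
      algebra_simps sum.distrib sum_subtractf sum_distrib_left)
  moreover have "?K' \<circ> ?L = id"
  proof
    fix v
    let ?u = "v - ?a v *\<^sub>R ?t"
    have "?u \<bullet> ?N x = 0" using tN by (simp add: inner_diff_left)
    then have "?u = (\<Sum>k\<in>UNIV. coord x ?u k *\<^sub>R E k x)"
      using frame_expansion[OF x, of ?u] by simp
    then have "?D (\<chi> k. coord x ?u k) = ?u"
      by (simp add: frechet_derivative_eq_sum_partial[OF differentiable_Y[OF x]])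
    then show "(?K' \<circ> ?L) v = id v" by simp
  qed
  moreover have "open (UNIV \<times> U :: (real \<times> (real^'n)) set)" using open_V by (intro open_Times) auto
  ultimately have "?K (0, x) \<in> interior (?K ` (UNIV \<times> U))"
    using cont deriv x by (intro sussmann_open_mapping[of "UNIV \<times> U" ?K "(0, x)" ?K' ?L]) (auto simp: interior_open)
  moreover have "?K ` (UNIV \<times> U) \<subseteq> position S ` topspace (manifold S)"
  proof -
    have "openin (manifold S) (\<phi> ` U)"
      using S U by (auto simp: immersed_hypersurface_def smooth_atlas_def local_parametrization_def)
    then have "\<phi> z \<in> topspace (manifold S)" if "z \<in> U" for z
      using openin_subset that by blast
    then show ?thesis
      using sym unfolding rotationally_symmetric_def by fastforce
  qed
  ultimately have "interior (position S ` topspace (manifold S)) \<noteq> {}"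
    using interior_mono by blast
  moreover have "negligible (interior (position S ` topspace (manifold S)))"
    using negligible_image_of_compact_hypersurface[OF assms(1,2)] interior_subset negligible_subset by blast
  ultimately show False
    using open_not_negligible open_interior by blast
qed

section \<open>The cross-section\<close>

lemma Ck_on_subset: "Ck_on k f U \<Longrightarrow> W \<subseteq> U \<Longrightarrow> Ck_on k f W"
  by (induction k arbitrary: f) (auto intro: continuous_on_subset)

lemma half_space_patch_subset:
  assumes "half_space_patch V Y N" "open W" "W \<subseteq> V"
  shows "half_space_patch W Y N"
proof -
  interpret half_space_patch V Y N by fact
  have "smooth_immersion_on Y W"
    using immersion \<open>W \<subseteq> V\<close> Ck_on_subset[of _ Y V W]
    by (auto simp: smooth_immersion_on_def smooth_on_def)
  then show ?thesis
    using assms(2,3) codim norm_N tangent_normal off_axis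
    by unfold_locales auto
qed

lemma cross_section_topspace:
  assumes "cross_section S \<Gamma>" "p \<in> topspace (manifold \<Gamma>)"
  shows "p \<in> topspace (manifold S)"
    and "half_space_embed (position \<Gamma> p) = position S p"
    and "fst (position \<Gamma> p) = norm (fst (position S p))"
proof -
  have eq: "position \<Gamma> p = (norm (fst (position S p)), snd (position S p))"
    using assms by (simp add: cross_section_def)
  have "p \<in> topspace (manifold S) \<and> (\<exists>r\<ge>0. fst (position S p) = complex_of_real r)"
    using assms by (auto simp: cross_section_def)
  then show "p \<in> topspace (manifold S)" "half_space_embed (position \<Gamma> p) = position S p"
    "fst (position \<Gamma> p) = norm (fst (position S p))"
    by (auto simp: half_space_embed_def eq prod_eq_iff)
qed

lemma local_parametrization_inverse:
  assumes "local_parametrization M U \<phi>"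
  obtains g where "continuous_map (subtopology M (\<phi> ` U)) (top_of_set U) g" "\<And>x. x \<in> U \<Longrightarrow> g (\<phi> x) = x"
  using assms unfolding local_parametrization_def homeomorphic_map_maps homeomorphic_maps_def by auto

lemma local_parametrization_continuous:
  assumes "local_parametrization M U \<phi>"
  shows "continuous_map (top_of_set U) M \<phi>"
  using assms continuous_map_into_fulltopology homeomorphic_imp_continuous_map
  unfolding local_parametrization_def by blast

text \<open>The atlas of the cross-section is related to that of \<open>S\<close> only through the topology. Hence the change of
  charts \<open>c\<close> is at first only continuous; its differentiability follows from
  \<open>differentiable_lift_through_immersion\<close>.\<close>

lemma cross_section_lift:
  assumes S: "immersed_hypersurface S" and \<Gamma>: "cross_section S \<Gamma>"
    and V: "(V, \<psi>) \<in> atlas \<Gamma>" and y: "y \<in> V"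
  obtains U \<phi> W c where "(U, \<phi>) \<in> atlas S" "open W" "W \<subseteq> V" "y \<in> W"
    "\<And>z. z \<in> W \<Longrightarrow> c z \<in> U" "\<And>z. z \<in> W \<Longrightarrow> isCont c z" "\<And>z. z \<in> W \<Longrightarrow> \<phi> (c z) = \<psi> z"
proof -
  have lpV: "local_parametrization (manifold \<Gamma>) V \<psi>"
    using V \<Gamma> by (auto simp: cross_section_def immersed_hypersurface_def smooth_atlas_def)
  then have "continuous_map (top_of_set V) (manifold \<Gamma>) \<psi>" by (rule local_parametrization_continuous)
  moreover have \<Gamma>M: "manifold \<Gamma> = subtopology (manifold S) {p. \<exists>r\<ge>0. fst (position S p) = complex_of_real r}"
    using \<Gamma> by (simp add: cross_section_def)
  ultimately have \<psi>: "continuous_map (top_of_set V) (manifold S) \<psi>"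
    by (simp add: continuous_map_in_subtopology)
  then have "\<psi> y \<in> topspace (manifold S)" using y by (auto simp: continuous_map_def)
  moreover have "(\<Union>(U, \<phi>)\<in>atlas S. \<phi> ` U) = topspace (manifold S)"
    using S by (simp add: immersed_hypersurface_def smooth_atlas_def)
  ultimately have "\<exists>a\<in>atlas S. \<psi> y \<in> (case a of (U, \<phi>) \<Rightarrow> \<phi> ` U)"
    by (simp only: UN_iff[symmetric])
  then obtain a where a: "a \<in> atlas S" "\<psi> y \<in> (case a of (U, \<phi>) \<Rightarrow> \<phi> ` U)" ..
  obtain U \<phi> where "a = (U, \<phi>)" by (cases a)
  with a have U: "(U, \<phi>) \<in> atlas S" "\<psi> y \<in> \<phi> ` U" by auto
  have lpU: "local_parametrization (manifold S) U \<phi>"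
    using S U(1) by (auto simp: immersed_hypersurface_def smooth_atlas_def)
  obtain g where g: "continuous_map (subtopology (manifold S) (\<phi> ` U)) (top_of_set U) g"
    "\<And>x. x \<in> U \<Longrightarrow> g (\<phi> x) = x"
    by (rule local_parametrization_inverse[OF lpU]) (rule that)
  define W where "W = {z \<in> V. \<psi> z \<in> \<phi> ` U}"
  have "openin (top_of_set V) W"
    using openin_continuous_map_preimage[OF \<psi>, of "\<phi> ` U"] lpU by (simp add: W_def local_parametrization_def)
  then have W: "open W"
    using lpV openin_open_trans by (auto simp: local_parametrization_def)
  have "continuous_map (top_of_set W) (subtopology (manifold S) (\<phi> ` U)) \<psi>"
    using continuous_map_from_subtopology_mono[OF \<psi>, of W]
    by (auto simp: continuous_map_in_subtopology W_def)
  from continuous_map_compose[OF this g(1)] have "continuous_on W (g \<circ> \<psi>)"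
    by (simp add: continuous_map_in_subtopology)
  then have "isCont (g \<circ> \<psi>) z" if "z \<in> W" for z
    using W that by (simp add: continuous_on_eq_continuous_at o_def)
  moreover have "(g \<circ> \<psi>) z \<in> U \<and> \<phi> ((g \<circ> \<psi>) z) = \<psi> z" if "z \<in> W" for z
    using that g(2) by (auto simp: W_def)
  ultimately show ?thesis
    using that[OF U(1) W, of "g \<circ> \<psi>"] y U(2) by (auto simp: W_def)
qed

theorem proposition7p1:
  fixes S :: "('p, 'n::finite, complex \<times> (real^'m::finite)) hypersurface"
    and \<Gamma> :: "('p, 'm, real \<times> (real^'m)) hypersurface"
    and n :: nat
    and u :: "'p \<Rightarrow> real"
  assumes "n = CARD('n)" and "CARD('m) = n - 1"
    and "immersed_hypersurface S"
    and "compact_space (manifold S)"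
    and "rotationally_symmetric S"
    and "self_shrinker S"
    and "\<forall>p\<in>topspace (manifold S). fst (position S p) \<noteq> 0"
    and "cross_section S \<Gamma>"
    and "\<forall>p\<in>topspace (manifold \<Gamma>). u p = inverse (sigma_weight n (position \<Gamma> p))"
  shows "\<forall>(V, \<psi>)\<in>atlas \<Gamma>. \<forall>y\<in>V.
    stability_op n 1 (position \<Gamma> \<circ> \<psi>) (unit_normal \<Gamma> \<circ> \<psi>) (u \<circ> \<psi>) y =
      (real n / 2 - scalar_curvature (position \<Gamma> \<circ> \<psi>) y) * u (\<psi> y)"
proof (clarify)
  fix V \<psi> y assume V: "(V, \<psi>) \<in> atlas \<Gamma>" and y: "y \<in> V"
  let ?Y = "position \<Gamma> \<circ> \<psi>" and ?M = "unit_normal \<Gamma> \<circ> \<psi>"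
  have \<Gamma>: "immersed_hypersurface \<Gamma>" using assms(8) by (simp add: cross_section_def)
  have "openin (manifold \<Gamma>) (\<psi> ` V)"
    using \<Gamma> V by (auto simp: immersed_hypersurface_def smooth_atlas_def local_parametrization_def)
  then have \<psi>: "\<psi> z \<in> topspace (manifold \<Gamma>)" if "z \<in> V" for z
    using openin_subset that by blast
  have half: "half_space_patch V ?Y ?M"
    unfolding half_space_patch_def half_space_patch_axioms_def
    using immersed_hypersurface_patch[OF \<Gamma> V] cross_section_topspace[OF assms(8) \<psi>] assms(7) by auto
  have "mean_curvature ?Y ?M y = log_weight_gradient (?Y y) \<bullet> ?M y"
  proof -
    obtain U \<phi> W c where U: "(U, \<phi>) \<in> atlas S" and W: "open W" "W \<subseteq> V" "y \<in> W"
      and c: "\<And>z. z \<in> W \<Longrightarrow> c z \<in> U" "\<And>z. z \<in> W \<Longrightarrow> isCont c z" "\<And>z. z \<in> W \<Longrightarrow> \<phi> (c z) = \<psi> z"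
      by (rule cross_section_lift[OF assms(3,8) V y]) (rule that)
    show ?thesis
    proof (rule mean_curvature_cross_section[OF immersed_hypersurface_patch[OF assms(3) U]
          half_space_patch_subset[OF half W(1,2)] W(3) c(1,2)])
      show "half_space_embed (?Y z) = (position S \<circ> \<phi>) (c z)" if "z \<in> W" for z
        using cross_section_topspace(2)[OF assms(8) \<psi>] W(2) that c(3)[OF that] by auto
      show "rotation_field ((position S \<circ> \<phi>) z) \<bullet> (unit_normal S \<circ> \<phi>) z = 0" if "z \<in> U" for z
        using rotation_field_tangent[OF assms(3,4,5) U that] by simp
      show "mean_curvature (position S \<circ> \<phi>) (unit_normal S \<circ> \<phi>) (c y)
          = 1/2 * ((position S \<circ> \<phi>) (c y) \<bullet> (unit_normal S \<circ> \<phi>) (c y))"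
        using assms(6) self_shrinker_iff[OF assms(3)] U c(1)[OF W(3)] by fastforce
    qed
  qed
  moreover have "real CARD('m) + 1 = real n"
    using assms(1,2) zero_less_card_finite[where 'a = 'm] by linarith
  ultimately have "stability_op n 1 ?Y ?M (\<lambda>z. inverse (sigma_weight n (?Y z))) y
      = (real n / 2 - scalar_curvature ?Y y) * inverse (sigma_weight n (?Y y))"
    using half_space_patch.stability_op_inverse_sigma_weight[OF half y, of n] by simp
  moreover have "u (\<psi> z) = inverse (sigma_weight n (?Y z))" if "z \<in> V" for z
    using assms(9) \<psi>[OF that] by simp
  moreover have "open V"
    using half half_space_patch.axioms(1) immersed_patch.open_V by blast
  ultimately show "stability_op n 1 ?Y ?M (u \<circ> \<psi>) y = (real n / 2 - scalar_curvature ?Y y) * u (\<psi> y)"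
    using stability_op_cong_open[of V y "u \<circ> \<psi>" "\<lambda>z. inverse (sigma_weight n (?Y z))"] y by simp
qed

end
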